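(* Let $\mathcal{A},\mathcal{B}$ be $C^*$-algebras, at least one of which is unital, and let $\phi:\mathcal{A}_+\to\mathcal{B}_+$ be a surjective map. Then $\|\phi(A)+\phi(B)\|=\|A+B\|$ for all $A,B\in\mathcal{A}_+$ if and only if there is a Jordan $*$-isomorphism $J:\mathcal{A}\to\mathcal{B}$ with $\phi(A)=J(A)$ for all $A\in\mathcal{A}_+$.
   Context: $\mathcal{A}_+$ denotes the cone of positive elements of a $C^*$-algebra $\mathcal{A}$. A Jordan $*$-isomorphism $J:\mathcal{A}\to\mathcal{B}$ is a bijective linear map with $J(A^* )=J(A)^*$ and $J(A^2)=J(A)^2$ for all $A\in\mathcal{A}$. *)

theory Defs
  imports "HOL-Analysis.Analysis"
begin

text \<open>Abstract (not necessarily unital) C*-algebras: complex Banach algebras with an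
involution satisfying the C*-identity. Since the distribution has no class of complex
vector spaces, the complex scalar multiplication is a class parameter, compatible
with the real one.\<close>

class cstar_algebra = real_normed_algebra + banach +
  fixes cscale :: "complex \<Rightarrow> 'a \<Rightarrow> 'a"
    and cstar :: "'a \<Rightarrow> 'a"
  assumes cscale_add_right: "cscale c (x + y) = cscale c x + cscale c y"
    and cscale_add_left: "cscale (c + d) x = cscale c x + cscale d x"
    and cscale_cscale: "cscale c (cscale d x) = cscale (c * d) x"
    and cscale_one: "cscale 1 x = x"
    and cscale_of_real: "cscale (complex_of_real r) x = scaleR r x"
    and norm_cscale: "norm (cscale c x) = cmod c * norm x"
    and cscale_mult_left: "cscale c x * y = cscale c (x * y)"
    and cscale_mult_right: "x * cscale c y = cscale c (x * y)"
    and cstar_cstar: "cstar (cstar x) = x"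
    and cstar_add: "cstar (x + y) = cstar x + cstar y"
    and cstar_cscale: "cstar (cscale c x) = cscale (cnj c) (cstar x)"
    and cstar_mult: "cstar (x * y) = cstar y * cstar x"
    and cstar_identity: "norm (cstar x * x) = norm x * norm x"

definition unital :: "'a::cstar_algebra itself \<Rightarrow> bool" where
  "unital _ \<longleftrightarrow> (\<exists>e::'a. \<forall>x. e * x = x \<and> x * e = x)"

text \<open>Quasi-invertibility: x is quasi-invertible iff 1 - x is invertible in the unitization.\<close>
definition quasi_invertible :: "'a::cstar_algebra \<Rightarrow> bool" where
  "quasi_invertible x \<longleftrightarrow> (\<exists>y. x + y - x * y = 0 \<and> x + y - y * x = 0)"

text \<open>Spectrum computed in the unitization (so 0 always belongs to it):
  for l \<noteq> 0, l - x is invertible in the unitization iff x/l is quasi-invertible.\<close>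
definition cspectrum :: "'a::cstar_algebra \<Rightarrow> complex set" where
  "cspectrum x = insert 0 {l. l \<noteq> 0 \<and> \<not> quasi_invertible (cscale (inverse l) x)}"

definition cpositive :: "'a::cstar_algebra \<Rightarrow> bool" where
  "cpositive x \<longleftrightarrow> cstar x = x \<and> cspectrum x \<subseteq> complex_of_real ` {0..}"

definition positive_cone :: "'a::cstar_algebra set" where
  "positive_cone = {x. cpositive x}"

definition jordan_star_iso :: "('a::cstar_algebra \<Rightarrow> 'b::cstar_algebra) \<Rightarrow> bool" where
  "jordan_star_iso J \<longleftrightarrow> bij J
     \<and> (\<forall>x y. J (x + y) = J x + J y)
     \<and> (\<forall>c x. J (cscale c x) = cscale c (J x))
     \<and> (\<forall>x. J (cstar x) = cstar (J x))
     \<and> (\<forall>x. J (x * x) = J x * J x)"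

end

theory Submission
  imports Defs
begin

text \<open>
  If \<open>A\<close> has a unit, then \<open>a \<le> b\<close> holds for positive \<open>a\<close>, \<open>b\<close> as soon as \<open>norm (a + c) \<le> norm (b + c)\<close>
  for all positive \<open>c\<close>: take \<open>c = norm b - b\<close>. Hence \<open>\<phi>\<close> is an order isomorphism of the positive cones.
  The unit is the only positive \<open>E\<close> with \<open>norm (E + c) = 1 + norm c\<close> for all positive \<open>c\<close>, so both
  algebras are unital and \<open>\<phi> t = t\<close> for scalars \<open>t\<close>. Comparing \<open>\<phi> (t - a)\<close> with \<open>t - \<phi> a\<close> in both
  directions gives \<open>\<phi> (t - a) = t - \<phi> a\<close>; therefore \<open>\<phi>\<close> preserves the least \<open>s\<close> with \<open>a - b \<le> s\<close>, is
  isometric and commutes with adding scalars. It extends to a surjective isometry of the self-adjoint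
  parts, which is linear by the Mazur--Ulam theorem, and Kadison's inequality for the extension and
  for its inverse shows that squares are preserved. Conversely, a Jordan *-isomorphism that maps one
  cone onto the other preserves the unit, hence the relation \<open>p \<le> t\<close>, hence the norms of positive
  elements.

  The theory of positive elements is built on the norm instead of the spectrum: a self-adjoint \<open>x\<close>
  is positive iff \<open>norm (t - x) \<le> t\<close> for some \<open>t\<close>, and such elements have square roots by the binomial
  series.
\<close>

section \<open>The involution\<close>

lemma cscale_zero_right [simp]: "cscale c (0::'a::cstar_algebra) = 0"
  using cscale_add_right[of c "0::'a" 0] by simp

lemma cscale_zero_left [simp]: "cscale 0 (x::'a::cstar_algebra) = 0"
  using cscale_add_left[of 0 0 x] by simp

lemma cscale_minus_right: "cscale c (- x) = - cscale c (x::'a::cstar_algebra)"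
  using cscale_add_right[of c x "- x"] by (simp add: eq_neg_iff_add_eq_0 add.commute)

lemma cscale_minus_left: "cscale (- c) x = - cscale c (x::'a::cstar_algebra)"
  using cscale_add_left[of c "- c" x] by (simp add: eq_neg_iff_add_eq_0 add.commute)

lemma cscale_diff_right: "cscale c (x - y) = cscale c x - cscale c (y::'a::cstar_algebra)"
  using cscale_add_right[of c x "- y"] by (simp add: cscale_minus_right)

lemma cscale_scaleR: "cscale c (r *\<^sub>R x) = r *\<^sub>R cscale c (x::'a::cstar_algebra)"
  by (simp add: cscale_of_real[symmetric] cscale_cscale mult.commute)

lemma bounded_linear_cscale: "bounded_linear (cscale c :: 'a::cstar_algebra \<Rightarrow> 'a)"
  by (rule bounded_linear_intro[where K = "cmod c"])
    (simp_all add: cscale_add_right cscale_scaleR norm_cscale mult.commute)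

lemma cstar_zero [simp]: "cstar (0::'a::cstar_algebra) = 0"
  using cstar_add[of "0::'a" 0] by simp

lemma cstar_minus: "cstar (- x) = - cstar (x::'a::cstar_algebra)"
  using cstar_add[of x "- x"] by (simp add: eq_neg_iff_add_eq_0 add.commute)

lemma cstar_diff: "cstar (x - y) = cstar x - cstar (y::'a::cstar_algebra)"
  using cstar_add[of x "- y"] by (simp add: cstar_minus)

lemma cstar_scaleR: "cstar (r *\<^sub>R x) = r *\<^sub>R cstar (x::'a::cstar_algebra)"
  using cstar_cscale[of "complex_of_real r" x] by (simp add: cscale_of_real)

text \<open>Cancel one factor \<open>norm x\<close> in the C*-identity after applying
  submultiplicativity. Using the result for \<open>cstar x\<close> as well makes the involution
  isometric.\<close>

lemma norm_le_norm_cstar: "norm x \<le> norm (cstar (x::'a::cstar_algebra))"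
proof (cases "x = 0")
  case False
  have "norm x * norm x \<le> norm (cstar x) * norm x"
    using norm_mult_ineq[of "cstar x" x] by (simp add: cstar_identity)
  with False show ?thesis by simp
qed simp

lemma norm_cstar [simp]: "norm (cstar x) = norm (x::'a::cstar_algebra)"
  using norm_le_norm_cstar[of x] norm_le_norm_cstar[of "cstar x"] by (simp add: cstar_cstar)

lemma bounded_linear_cstar: "bounded_linear (cstar :: 'a::cstar_algebra \<Rightarrow> 'a)"
  by (rule bounded_linear_intro[where K = 1]) (simp_all add: cstar_add cstar_scaleR)

lemma norm_self_adjoint_square:
  "cstar x = x \<Longrightarrow> norm (x * x) = norm x * norm (x::'a::cstar_algebra)"
  using cstar_identity[of x] by simp

lemma norm_mult_cstar: "norm (x * cstar x) = norm x * norm (x::'a::cstar_algebra)"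
  using cstar_identity[of "cstar x"] by (simp add: cstar_cstar)

lemma mult_cstar_eq_0: "x * cstar x = 0 \<Longrightarrow> x = (0::'a::cstar_algebra)"
  using norm_mult_cstar[of x] by simp

lemma self_adjoint_square_eq_0:
  "cstar x = x \<Longrightarrow> x * x = 0 \<Longrightarrow> x = (0::'a::cstar_algebra)"
  using mult_cstar_eq_0[of x] by simp

section \<open>Square roots by the binomial series\<close>

text \<open>Nonzero C*-algebras with a distinguished unit, since \<open>norm 1 = 1\<close> is
  imposed. The instance used is the unitization; a unit of a given algebra is handled by the
  predicate \<open>is_unity\<close>, which also covers the zero algebra.\<close>

class cstar_algebra_1 = cstar_algebra + real_normed_algebra_1

lemma cstar_one [simp]: "cstar (1::'a::cstar_algebra_1) = 1"
  by (metis cstar_cstar cstar_mult mult.right_neutral)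

text \<open>The Taylor coefficients at 0 of the square root of \<open>1 - x\<close>.\<close>

definition sqrt_coeff :: "nat \<Rightarrow> real"
  where "sqrt_coeff n = (- 1) ^ n * ((1 / 2) gchoose n)"

lemma sqrt_coeff_eq: "sqrt_coeff n = pochhammer (- 1 / 2) n / fact n"
  by (simp add: sqrt_coeff_def gbinomial_pochhammer flip: power_add mult_2)

text \<open>The first factor of the Pochhammer product is \<open>- 1 / 2\<close>; the remaining ones
  are 1/2, 3/2 and so on.\<close>

lemma sqrt_coeff_nonpos: "sqrt_coeff (Suc n) \<le> 0"
proof -
  have "pochhammer (- 1 / 2 + 1 :: real) n \<ge> 0"
    by (cases n) (auto intro!: less_imp_le pochhammer_pos)
  then show ?thesis
    by (simp add: sqrt_coeff_eq pochhammer_rec mult_nonpos_nonneg divide_nonpos_pos)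
qed

text \<open>Alternating partial sums of binomial coefficients have a closed form, which here is a
  product of positive factors divided by a factorial.\<close>

lemma sum_sqrt_coeff_nonneg: "(\<Sum>k\<le>n. sqrt_coeff k) \<ge> 0"
proof -
  have "(\<Sum>k\<le>n. sqrt_coeff k) = (- 1) ^ n * ((1 / 2 - 1) gchoose n)"
    using gbinomial_sum_lower_neg[of "1 / 2 :: real" n]
    by (simp add: sqrt_coeff_def mult.commute)
  also have "\<dots> = pochhammer (1 / 2) n / fact n"
    by (simp add: gbinomial_pochhammer flip: power_add mult_2)
  also have "\<dots> \<ge> 0"
    by (intro divide_nonneg_pos less_imp_le[OF pochhammer_pos]) auto
  finally show ?thesis .
qed

text \<open>Only the constant coefficient 1 is positive, so the sum of the absolute values is 2
  minus the nonnegative sum of the coefficients. This gives absolute convergence on the closed unit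
  ball.\<close>

lemma sum_abs_sqrt_coeff_le: "(\<Sum>k\<le>n. \<bar>sqrt_coeff k\<bar>) \<le> 2"
proof -
  have "(\<Sum>k\<le>n. \<bar>sqrt_coeff k\<bar>) = 2 - (\<Sum>k\<le>n. sqrt_coeff k)"
  proof (induction n)
    case (Suc n)
    then show ?case using sqrt_coeff_nonpos[of n] by simp
  qed (simp add: sqrt_coeff_def)
  then show ?thesis
    using sum_sqrt_coeff_nonneg[of n] by simp
qed

lemma summable_abs_sqrt_coeff: "summable (\<lambda>n. \<bar>sqrt_coeff n\<bar>)"
  by (rule bounded_imp_summable[OF _ sum_abs_sqrt_coeff_le]) simp

lemma suminf_abs_sqrt_coeff_Suc_le: "(\<Sum>n. \<bar>sqrt_coeff (Suc n)\<bar>) \<le> 1"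
proof -
  have "(\<Sum>n. \<bar>sqrt_coeff n\<bar>) \<le> 2"
  proof (rule suminf_le_const[OF summable_abs_sqrt_coeff])
    fix n
    have "(\<Sum>k<n. \<bar>sqrt_coeff k\<bar>) \<le> (\<Sum>k\<le>n. \<bar>sqrt_coeff k\<bar>)"
      by (intro sum_mono2) auto
    then show "(\<Sum>k<n. \<bar>sqrt_coeff k\<bar>) \<le> 2"
      using sum_abs_sqrt_coeff_le[of n] by linarith
  qed
  then show ?thesis
    using suminf_split_head[OF summable_abs_sqrt_coeff] by (simp add: sqrt_coeff_def)
qed

text \<open>Vandermonde's identity with both upper arguments 1/2: the formal square of the series is
  \<open>1 - x\<close>.\<close>

lemma sqrt_coeff_convolution:
  "(\<Sum>i\<le>k. sqrt_coeff i * sqrt_coeff (k - i)) = (if k = 0 then 1 else if k = 1 then - 1 else 0)"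
proof -
  have "(\<Sum>i\<le>k. sqrt_coeff i * sqrt_coeff (k - i))
      = (\<Sum>i\<le>k. (- 1) ^ k * (((1 / 2) gchoose i) * ((1 / 2) gchoose (k - i))))"
    by (rule sum.cong) (auto simp: sqrt_coeff_def simp flip: power_add)
  also have "\<dots> = (- 1) ^ k * (1 gchoose k)"
    using gbinomial_Vandermonde[of "1 / 2 :: real" "1 / 2" k]
    by (simp add: atLeast0AtMost flip: sum_distrib_left)
  also have "(1::real) gchoose k = of_nat (1 choose k)"
    using binomial_gbinomial[of 1 k, where 'a = real] by simp
  finally show ?thesis by (cases k) (auto simp: binomial_eq_0)
qed

text \<open>\<open>s\<close> is the binomial series in \<open>x\<close>, squared by the Cauchy
  product. The bound on \<open>norm (1 - s)\<close> is what makes a self-adjoint \<open>s\<close>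
  positive, with \<open>t = 1\<close>; self-adjointness and commutation hold term by term.\<close>

lemma ex_sqrt_one_minus:
  fixes x :: "'a::cstar_algebra_1"
  assumes x: "norm x \<le> 1"
  obtains s where "s * s = 1 - x" "norm (1 - s) \<le> 1" "cstar x = x \<Longrightarrow> cstar s = s"
    "\<And>y. y * x = x * y \<Longrightarrow> y * s = s * y"
proof
  define c where "c = (\<lambda>n. sqrt_coeff n *\<^sub>R x ^ n)"
  define s where "s = suminf c"
  have le: "norm (c n) \<le> \<bar>sqrt_coeff n\<bar>" for n
  proof -
    have "norm (x ^ n) \<le> 1"
      using norm_power_ineq[of x n] power_le_one[OF _ x, of n] by simp
    then show ?thesis by (simp add: c_def mult_left_le)
  qed
  have sn: "summable (\<lambda>n. norm (c n))"
    by (rule summable_comparison_test'[OF summable_abs_sqrt_coeff, of 0]) (simp add: le)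
  then have sc: "summable c" by (rule summable_norm_cancel)
  have "(\<lambda>k. \<Sum>i\<le>k. c i * c (k - i)) sums (s * s)"
    unfolding s_def by (rule Cauchy_product_sums[OF sn sn])
  moreover have "(\<Sum>i\<le>k. c i * c (k - i)) = (if k = 0 then 1 else if k = 1 then - x else 0)" for k
  proof -
    have "(\<Sum>i\<le>k. c i * c (k - i)) = (\<Sum>i\<le>k. sqrt_coeff i * sqrt_coeff (k - i)) *\<^sub>R x ^ k"
      by (auto simp: c_def scaleR_sum_left mult.commute simp flip: power_add intro!: sum.cong)
    then show ?thesis by (simp add: sqrt_coeff_convolution)
  qed
  moreover have "(\<lambda>k. if k = 0 then 1 else if k = 1 then - x else 0) sums (1 - x)"
    using sums_finite[of "{0, 1::nat}" "\<lambda>k. if k = 0 then 1 else if k = 1 then - x else 0"] by simp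
  ultimately show "s * s = 1 - x"
    by (simp add: sums_unique2)
  have "norm (s - 1) \<le> 1"
  proof -
    have "s - 1 = (\<Sum>n. c (Suc n))"
      using suminf_split_head[OF sc] by (simp add: s_def c_def sqrt_coeff_def)
    also have "norm \<dots> \<le> (\<Sum>n. norm (c (Suc n)))"
      using sn summable_Suc_iff[of "\<lambda>n. norm (c n)"] by (intro summable_norm) simp
    also have "\<dots> \<le> (\<Sum>n. \<bar>sqrt_coeff (Suc n)\<bar>)"
      using sn summable_abs_sqrt_coeff
      by (intro suminf_le le) (simp_all only: summable_Suc_iff[of "\<lambda>n. norm (c n)"] summable_Suc_iff[of "\<lambda>n. \<bar>sqrt_coeff n\<bar>"])
    finally show ?thesis using suminf_abs_sqrt_coeff_Suc_le by linarith
  qed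
  then show "norm (1 - s) \<le> 1" by (simp add: norm_minus_commute)
  show "cstar s = s" if "cstar x = x"
  proof -
    have "cstar (x ^ n) = x ^ n" for n
      by (induction n) (simp_all add: cstar_mult that power_commutes)
    then have "cstar (c n) = c n" for n
      by (simp add: c_def cstar_scaleR)
    then show ?thesis
      using bounded_linear.suminf[OF bounded_linear_cstar sc] by (simp add: s_def)
  qed
  show "y * s = s * y" if "y * x = x * y" for y
  proof -
    have "y * x ^ n = x ^ n * y" for n
      using power_commuting_commutes[of x y n] that by simp
    then have "y * c n = c n * y" for n
      by (simp add: c_def)
    then show ?thesis
      using suminf_mult[OF sc, of y] suminf_mult2[OF sc, of y] by (simp add: s_def)
  qed
qed

section \<open>Positivity in unital C*-algebras\<close>

text \<open>For self-adjoint \<open>x\<close> the inequality places the spectrum in the interval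
  from 0 to \<open>2 * t\<close>. Once some \<open>t\<close> works, every \<open>t\<close> with
  \<open>norm x \<le> t\<close> does, by \<open>norm_const_minus_norm_positive\<close>.\<close>

definition norm_positive :: "'a::cstar_algebra_1 \<Rightarrow> bool"
  where "norm_positive x \<longleftrightarrow> cstar x = x \<and> (\<exists>t. norm (t *\<^sub>R 1 - x) \<le> t)"

lemma norm_positiveI: "cstar x = x \<Longrightarrow> norm (t *\<^sub>R 1 - x) \<le> t \<Longrightarrow> norm_positive x"
  by (auto simp: norm_positive_def)

lemma norm_positive_self_adjoint: "norm_positive x \<Longrightarrow> cstar x = x"
  by (simp add: norm_positive_def)

lemma norm_positive_0 [simp]: "norm_positive 0"
  by (rule norm_positiveI[of _ 0]) simp_all

text \<open>The witnesses add up by the triangle inequality; with the spectral definition closure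
  under sums would be far less direct.\<close>

lemma norm_positive_add:
  assumes "norm_positive x" "norm_positive y"
  shows "norm_positive (x + y)"
proof -
  obtain t u where tu: "norm (t *\<^sub>R 1 - x) \<le> t" "norm (u *\<^sub>R 1 - y) \<le> u"
    using assms by (auto simp: norm_positive_def)
  have "(t + u) *\<^sub>R 1 - (x + y) = (t *\<^sub>R 1 - x) + (u *\<^sub>R 1 - y)"
    by (simp add: algebra_simps)
  then have "norm ((t + u) *\<^sub>R 1 - (x + y)) \<le> t + u"
    using norm_triangle_mono[OF tu] by (simp only:)
  then show ?thesis
    using assms by (intro norm_positiveI) (auto simp: norm_positive_def cstar_add)
qed

lemma norm_positive_scaleR:
  assumes "norm_positive x" "0 \<le> r"
  shows "norm_positive (r *\<^sub>R x)"
proof -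
  obtain t where t: "norm (t *\<^sub>R 1 - x) \<le> t"
    using assms by (auto simp: norm_positive_def)
  have "(r * t) *\<^sub>R 1 - r *\<^sub>R x = r *\<^sub>R (t *\<^sub>R 1 - x)"
    by (simp add: algebra_simps)
  then have "norm ((r * t) *\<^sub>R 1 - r *\<^sub>R x) \<le> r * t"
    using t assms(2) by (simp add: mult_left_mono)
  then show ?thesis
    using assms by (intro norm_positiveI) (auto simp: norm_positive_def cstar_scaleR)
qed

lemma norm_positive_const: "0 \<le> r \<Longrightarrow> norm_positive (r *\<^sub>R 1)"
  by (rule norm_positiveI[of _ r]) (simp_all add: cstar_scaleR)

lemma norm_positive_const_minus:
  assumes "cstar x = x" "norm x \<le> t"
  shows "norm_positive (t *\<^sub>R 1 - x)"
  using assms by (intro norm_positiveI[of _ t]) (simp_all add: cstar_diff cstar_scaleR)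

text \<open>Rescaling by the witness gives \<open>x = t *\<^sub>R (1 - z)\<close> with
  \<open>norm z \<le> 1\<close>, so the binomial root of \<open>1 - z\<close> times
  \<open>sqrt t\<close> is a root of \<open>x\<close>.\<close>

lemma norm_positive_sqrt:
  assumes "norm_positive x"
  obtains s where "s * s = x" "norm_positive s" "\<And>y. y * x = x * y \<Longrightarrow> y * s = s * y"
proof -
  obtain t where t: "norm (t *\<^sub>R 1 - x) \<le> t" and sa: "cstar x = x"
    using assms by (auto simp: norm_positive_def)
  have "0 \<le> t" using t norm_ge_zero order_trans by blast
  show ?thesis
  proof (cases "t = 0")
    case True
    with t have "x = 0" by simp
    then show ?thesis using that[of 0] by simp
  next
    case False
    with \<open>0 \<le> t\<close> have "0 < t" by simp
    define z where "z = 1 - (1 / t) *\<^sub>R x"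
    have "z = (1 / t) *\<^sub>R (t *\<^sub>R 1 - x)"
      using \<open>0 < t\<close> by (simp add: z_def algebra_simps)
    then have "norm z \<le> 1" using t \<open>0 < t\<close> by simp
    then obtain r where r: "r * r = 1 - z" "norm (1 - r) \<le> 1" "cstar z = z \<Longrightarrow> cstar r = r"
      "\<And>y. y * z = z * y \<Longrightarrow> y * r = r * y"
      by (rule ex_sqrt_one_minus) blast
    have "cstar z = z" by (simp add: z_def cstar_diff cstar_scaleR sa)
    then have "norm_positive r" using r(2,3) by (intro norm_positiveI[of _ 1]) simp_all
    show ?thesis
    proof (rule that[of "sqrt t *\<^sub>R r"])
      show "(sqrt t *\<^sub>R r) * (sqrt t *\<^sub>R r) = x"
        using \<open>0 < t\<close> r(1) by (simp add: z_def)
      show "norm_positive (sqrt t *\<^sub>R r)"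
        using \<open>norm_positive r\<close> \<open>0 < t\<close> by (simp add: norm_positive_scaleR)
      show "y * (sqrt t *\<^sub>R r) = (sqrt t *\<^sub>R r) * y" if "y * x = x * y" for y
      proof -
        have "y * z = z * y" using that by (simp add: z_def right_diff_distrib left_diff_distrib)
        then have "y * r = r * y" by (rule r(4))
        then show ?thesis by simp
      qed
    qed
  qed
qed

text \<open>The element \<open>u = s + \<i> r\<close> satisfies \<open>u\<^sup>* u = s\<^sup>2 + r\<^sup>2\<close>, and \<open>s\<close>, \<open>r\<close> are recovered from
  \<open>u\<close> and \<open>u\<^sup>*\<close>.\<close>

lemma norm_le_of_sum_squares:
  fixes s r :: "'a::cstar_algebra"
  assumes "cstar s = s" "cstar r = r" "s * r = r * s" "0 \<le> k" "norm (s * s + r * r) \<le> k * k"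
  shows "norm s \<le> k" "norm r \<le> k"
proof -
  define u where "u = s + cscale \<i> r"
  have cu: "cstar u = s - cscale \<i> r"
    by (simp add: u_def cstar_add cstar_cscale assms cscale_minus_left)
  have "cstar u * u = s * s + r * r"
    unfolding cu unfolding u_def
    by (simp add: algebra_simps cscale_mult_left cscale_mult_right cscale_cscale
        cscale_minus_left cscale_diff_right cscale_one assms(3))
  then have "norm u * norm u \<le> k * k"
    using assms(5) cstar_identity[of u] by simp
  then have k: "norm u \<le> k"
    using assms(4) abs_le_square_iff[of "norm u" k] by (simp add: power2_eq_square)
  have "2 *\<^sub>R s = u + cstar u" by (simp add: cu scaleR_2) (simp add: u_def)
  then have "2 * norm s \<le> 2 * norm u"
    using norm_triangle_ineq[of u "cstar u"] norm_scaleR[of 2 s] by simp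
  with k show "norm s \<le> k" by simp
  have "2 *\<^sub>R cscale \<i> r = u - cstar u" by (simp add: cu scaleR_2) (simp add: u_def)
  then have "2 * norm r \<le> 2 * norm u"
    using norm_triangle_ineq4[of u "cstar u"] norm_scaleR[of 2 "cscale \<i> r"]
    by (simp add: norm_cscale)
  with k show "norm r \<le> k" by simp
qed

text \<open>The complement \<open>t - s * s\<close> is positive and has a root \<open>r\<close>
  commuting with \<open>s\<close>. Since the squares of \<open>s\<close> and \<open>r\<close> add up
  to \<open>t\<close>, \<open>norm_le_of_sum_squares\<close> bounds \<open>norm r\<close>, hence the
  norm of \<open>r * r\<close>.\<close>

lemma norm_const_minus_square:
  fixes s :: "'a::cstar_algebra_1"
  assumes sa: "cstar s = s" and le: "norm s * norm s \<le> t"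
  shows "norm (t *\<^sub>R 1 - s * s) \<le> t"
proof -
  have "0 \<le> t" using le zero_le_square order_trans by blast
  have "norm_positive (t *\<^sub>R 1 - s * s)"
    using le by (intro norm_positive_const_minus)
      (simp_all add: cstar_mult sa norm_self_adjoint_square)
  then obtain r where r: "r * r = t *\<^sub>R 1 - s * s" "norm_positive r"
    "\<And>y. y * (t *\<^sub>R 1 - s * s) = (t *\<^sub>R 1 - s * s) * y \<Longrightarrow> y * r = r * y"
    by (rule norm_positive_sqrt) blast
  have "s * r = r * s" by (rule r(3)) (simp add: algebra_simps)
  moreover have "cstar r = r" using r(2) by (rule norm_positive_self_adjoint)
  ultimately have "norm r \<le> sqrt t"
    using \<open>0 \<le> t\<close> by (intro norm_le_of_sum_squares(2)[of s r]) (simp_all add: sa r(1))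
  then have "norm r * norm r \<le> sqrt t * sqrt t"
    by (intro mult_mono) (use \<open>0 \<le> t\<close> in auto)
  then show ?thesis
    using r(1) norm_self_adjoint_square[OF \<open>cstar r = r\<close>] \<open>0 \<le> t\<close> by simp
qed

lemma norm_positive_square: "cstar s = s \<Longrightarrow> norm_positive (s * s)"
  using norm_const_minus_square[of s "norm s * norm s"]
  by (auto intro: norm_positiveI simp: cstar_mult)

text \<open>Apply the preceding bound to a square root of \<open>x\<close>. A common
  \<open>t\<close> for a bounded family of positive elements makes the cone closed.\<close>

lemma norm_const_minus_norm_positive:
  assumes "norm_positive x" "norm x \<le> t"
  shows "norm (t *\<^sub>R 1 - x) \<le> t"
proof -
  obtain s where "s * s = x" "norm_positive s"
    using assms(1) by (rule norm_positive_sqrt) blast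
  then show ?thesis
    using norm_const_minus_square[of s t] assms(2) norm_self_adjoint_square[of s]
    by (auto simp: norm_positive_self_adjoint)
qed

lemma norm_positive_LIMSEQ:
  assumes "\<And>n. norm_positive (X n)" "X \<longlonglongrightarrow> x"
  shows "norm_positive x"
proof -
  have "Bseq X" using assms(2) by (intro convergent_imp_Bseq convergentI)
  then obtain T where T: "\<And>n. norm (X n) \<le> T" by (auto simp: Bseq_def)
  have "cstar x = x"
    using bounded_linear.tendsto[OF bounded_linear_cstar assms(2)] assms
    by (simp add: norm_positive_self_adjoint LIMSEQ_unique)
  moreover have "norm (T *\<^sub>R 1 - x) \<le> T"
  proof (rule Lim_bounded)
    show "(\<lambda>n. norm (T *\<^sub>R 1 - X n)) \<longlonglongrightarrow> norm (T *\<^sub>R 1 - x)"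
      by (intro tendsto_intros assms)
    show "\<forall>n\<ge>0. norm (T *\<^sub>R 1 - X n) \<le> T"
      using norm_const_minus_norm_positive[OF assms(1) T] by simp
  qed
  ultimately show ?thesis by (rule norm_positiveI)
qed

text \<open>Commuting roots \<open>s\<close> of \<open>p\<close> and \<open>r\<close> of
  \<open>q\<close> exhibit the product as the square of the self-adjoint element
  \<open>s * r\<close>.\<close>

lemma norm_positive_mult:
  assumes "norm_positive p" "norm_positive q" "p * q = q * p"
  shows "norm_positive (p * q)"
proof -
  obtain s where s: "s * s = p" "norm_positive s" "\<And>y. y * p = p * y \<Longrightarrow> y * s = s * y"
    using assms(1) by (rule norm_positive_sqrt) blast
  obtain r where r: "r * r = q" "norm_positive r" "\<And>y. y * q = q * y \<Longrightarrow> y * r = r * y"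
    using assms(2) by (rule norm_positive_sqrt) blast
  \<comment> \<open>First \<open>p\<close> commutes with \<open>q\<close>, hence with its root
    \<open>r\<close>; then \<open>r\<close> commutes with \<open>p\<close>, hence with its root
    \<open>s\<close>.\<close>
  have rs: "r * s = s * r"
    using s(3)[of r] r(3)[of p] assms(3) by metis
  have "norm_positive ((s * r) * (s * r))"
    using s(2) r(2) by (intro norm_positive_square) (simp add: cstar_mult norm_positive_self_adjoint rs)
  also have "(s * r) * (s * r) = p * q"
    using rs s(1) r(1) by (metis mult.assoc)
  finally show ?thesis .
qed

text \<open>The roots of \<open>p\<close> and of \<open>t - p\<close> commute and their squares add
  up to \<open>t\<close>, so \<open>norm_le_of_sum_squares\<close> bounds the root of
  \<open>p\<close> by \<open>sqrt t\<close>.\<close>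

lemma norm_le_of_norm_positive:
  assumes "norm_positive p" "norm_positive (t *\<^sub>R 1 - p)" "0 \<le> t"
  shows "norm p \<le> t"
proof -
  obtain s where s: "s * s = p" "norm_positive s" "\<And>y. y * p = p * y \<Longrightarrow> y * s = s * y"
    using assms(1) by (rule norm_positive_sqrt) blast
  obtain r where r: "r * r = t *\<^sub>R 1 - p" "norm_positive r"
    "\<And>y. y * (t *\<^sub>R 1 - p) = (t *\<^sub>R 1 - p) * y \<Longrightarrow> y * r = r * y"
    using assms(2) by (rule norm_positive_sqrt) blast
  have "p * r = r * p" by (rule r(3)) (simp add: algebra_simps)
  then have rs: "s * r = r * s" using s(3)[of r] by metis
  have sa: "cstar s = s" using s(2) by (rule norm_positive_self_adjoint)
  have "norm s \<le> sqrt t"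
    using r(2) rs assms(3) by (intro norm_le_of_sum_squares(1)[of s r]) (simp_all add: sa norm_positive_self_adjoint r(1) s(1))
  then have "norm s * norm s \<le> sqrt t * sqrt t"
    by (intro mult_mono) (use assms(3) in auto)
  then show ?thesis
    using s(1) norm_self_adjoint_square[OF sa] assms(3) by simp
qed

lemma norm_positive_antisym: "norm_positive x \<Longrightarrow> norm_positive (- x) \<Longrightarrow> x = 0"
  using norm_le_of_norm_positive[of x 0] by simp

section \<open>Invertible elements and agreement with the spectral definition of positivity\<close>

definition two_sided_unit :: "'a::monoid_mult \<Rightarrow> bool"
  where "two_sided_unit x \<longleftrightarrow> (\<exists>y. x * y = 1 \<and> y * x = 1)"

lemma two_sided_unit_scaleR:
  fixes x :: "'a::real_algebra_1"
  assumes "two_sided_unit x" "r \<noteq> 0"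
  shows "two_sided_unit (r *\<^sub>R x)"
proof -
  obtain y where "x * y = 1" "y * x = 1" using assms(1) by (auto simp: two_sided_unit_def)
  then show ?thesis
    using assms(2) by (auto simp: two_sided_unit_def intro!: exI[of _ "(1 / r) *\<^sub>R y"])
qed

text \<open>The inverse \<open>g\<close> of the product gives a right inverse \<open>b * g\<close>
  and a left inverse \<open>g * b\<close> of \<open>a\<close>, and these coincide.\<close>

lemma two_sided_unit_factor:
  assumes "two_sided_unit (a * b)" "a * b = b * a"
  shows "two_sided_unit a"
proof -
  obtain g where g: "a * b * g = 1" "g * (a * b) = 1"
    using assms(1) by (auto simp: two_sided_unit_def)
  have "a * (b * g) = 1" "(g * b) * a = 1"
    using g assms(2) by (metis mult.assoc)+
  moreover from this have "g * b = b * g"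
    by (metis mult.assoc mult_1_left mult_1_right)
  ultimately show ?thesis by (auto simp: two_sided_unit_def)
qed

text \<open>Jacobson's formula: if \<open>u\<close> inverts \<open>1 + a * b\<close>, then
  \<open>1 - b * u * a\<close> inverts \<open>1 + b * a\<close>.\<close>

lemma two_sided_unit_one_plus_swap:
  fixes a b :: "'a::ring_1"
  assumes "two_sided_unit (1 + a * b)"
  shows "two_sided_unit (1 + b * a)"
proof -
  obtain u where u: "(1 + a * b) * u = 1" "u * (1 + a * b) = 1"
    using assms by (auto simp: two_sided_unit_def)
  have "(1 + b * a) * (1 - b * u * a) = 1 + b * (1 - (1 + a * b) * u) * a"
    by (simp add: algebra_simps)
  moreover have "(1 - b * u * a) * (1 + b * a) = 1 + b * (1 - u * (1 + a * b)) * a"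
    by (simp add: algebra_simps)
  ultimately show ?thesis
    unfolding two_sided_unit_def using u by (intro exI[of _ "1 - b * u * a"]) simp
qed

lemma two_sided_unit_one_minus:
  fixes x :: "'a::{real_normed_algebra_1,banach}"
  assumes "norm x < 1"
  shows "two_sided_unit (1 - x)"
proof -
  have s: "summable (\<lambda>n. x ^ n)"
    using assms by (rule complete_algebra_summable_geometric)
  define S where "S = (\<Sum>n. x ^ n)"
  have "(\<Sum>n. x ^ Suc n) = S - 1"
    using suminf_split_head[OF s] by (simp add: S_def)
  then have "x * S = S - 1" "S * x = S - 1"
    using suminf_mult[OF s, of x] suminf_mult2[OF s, of x]
    by (simp_all add: S_def power_commutes)
  then show ?thesis
    unfolding two_sided_unit_def by (intro exI[of _ S]) (simp add: algebra_simps)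
qed

text \<open>Write the element as \<open>T *\<^sub>R (1 - z)\<close>; positivity of \<open>x\<close>
  bounds the norm of \<open>norm x - x\<close> by \<open>norm x\<close>, so
  \<open>norm z < 1\<close> and the Neumann series applies.\<close>

lemma two_sided_unit_norm_positive_add:
  fixes x :: "'a::cstar_algebra_1"
  assumes "norm_positive x" "0 < \<epsilon>"
  shows "two_sided_unit (x + \<epsilon> *\<^sub>R 1)"
proof -
  define T where "T = norm x + \<epsilon>"
  have "0 < T" using assms(2) by (simp add: T_def add_nonneg_pos)
  define z where "z = (1 / T) *\<^sub>R (norm x *\<^sub>R 1 - x)"
  have "norm (norm x *\<^sub>R 1 - x) \<le> norm x"
    by (rule norm_const_minus_norm_positive[OF assms(1)]) simp
  then have "norm z < 1"
    using \<open>0 < T\<close> assms(2) by (simp add: z_def T_def)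
  then have "two_sided_unit (T *\<^sub>R (1 - z))"
    using \<open>0 < T\<close> by (intro two_sided_unit_scaleR two_sided_unit_one_minus) auto
  moreover have "T *\<^sub>R (1 - z) = x + \<epsilon> *\<^sub>R 1"
    using \<open>0 < T\<close> by (simp add: z_def scaleR_diff_right) (simp add: T_def algebra_simps)
  ultimately show ?thesis by simp
qed

text \<open>If \<open>M\<close> bounds the norm of the inverse \<open>y\<close>, then
  \<open>M - y\<close> is positive and commutes with \<open>d\<close>, so its product with
  \<open>d\<close>, namely \<open>M d - 1\<close>, is positive.\<close>

lemma norm_positive_unit_bounded_below:
  fixes d :: "'a::cstar_algebra_1"
  assumes "norm_positive d" "two_sided_unit d"
  obtains \<delta> where "0 < \<delta>" "\<delta> \<le> 1" "norm_positive (d - \<delta> *\<^sub>R 1)"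
proof -
  obtain y where y: "d * y = 1" "y * d = 1" using assms(2) by (auto simp: two_sided_unit_def)
  have sa: "cstar d = d" using assms(1) by (rule norm_positive_self_adjoint)
  have "cstar y * d = 1" using y(1) cstar_mult[of d y] sa by simp
  then have "cstar y = y" using y by (metis mult.assoc mult_1_left mult_1_right)
  \<comment> \<open>The added 1 gives \<open>M \<ge> 1\<close>, so that \<delta> =
    \<open>1 / M\<close> is at most 1.\<close>
  define M where "M = norm y + 1"
  have M: "1 \<le> M" by (simp add: M_def)
  have "norm_positive (M *\<^sub>R 1 - y)"
    by (rule norm_positive_const_minus) (simp_all add: \<open>cstar y = y\<close> M_def)
  then have "norm_positive ((M *\<^sub>R 1 - y) * d)"
    using assms(1) by (rule norm_positive_mult) (simp add: algebra_simps y)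
  then have "norm_positive ((1 / M) *\<^sub>R ((M *\<^sub>R 1 - y) * d))"
    using M by (intro norm_positive_scaleR) auto
  also have "(1 / M) *\<^sub>R ((M *\<^sub>R 1 - y) * d) = d - (1 / M) *\<^sub>R 1"
    using M by (simp add: algebra_simps y)
  finally show ?thesis using that[of "1 / M"] M by simp
qed

lemma quasi_invertible_iff: "quasi_invertible x \<longleftrightarrow> two_sided_unit (1 - x)"
  for x :: "'a::cstar_algebra_1"
proof
  assume "quasi_invertible x"
  then obtain y where y: "x + y - x * y = 0" "x + y - y * x = 0"
    unfolding quasi_invertible_def by blast
  have "(1 - x) * (1 - y) = 1 - (x + y - x * y)" "(1 - y) * (1 - x) = 1 - (x + y - y * x)"
    by (simp_all add: algebra_simps)
  then show "two_sided_unit (1 - x)"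
    unfolding two_sided_unit_def using y by (intro exI[of _ "1 - y"]) simp
next
  assume "two_sided_unit (1 - x)"
  then obtain u where u: "(1 - x) * u = 1" "u * (1 - x) = 1"
    by (auto simp: two_sided_unit_def)
  have "x + (1 - u) - x * (1 - u) = 1 - (1 - x) * u" "x + (1 - u) - (1 - u) * x = 1 - u * (1 - x)"
    by (simp_all add: algebra_simps)
  then show "quasi_invertible x"
    unfolding quasi_invertible_def using u by (intro exI[of _ "1 - u"]) simp
qed

text \<open>Multiply by the factor with the conjugate scalar and complete the square: the product is
  \<open>k * k\<close> plus a positive constant, hence invertible. Thus self-adjoint elements have
  real spectrum.\<close>

lemma two_sided_unit_one_minus_cscale:
  fixes x :: "'a::cstar_algebra_1"
  assumes "cstar x = x" "Im m \<noteq> 0"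
  shows "two_sided_unit (1 - cscale m x)"
proof -
  have m: "cmod m > 0" using assms(2) by (metis zero_complex.simps(2) zero_less_norm_iff)
  define k where "k = cmod m *\<^sub>R x - (Re m / cmod m) *\<^sub>R 1"
  define \<epsilon> where "\<epsilon> = (Im m / cmod m)\<^sup>2"
  have k: "cstar k = k" by (simp add: k_def cstar_diff cstar_scaleR assms(1))
  have "\<epsilon> > 0" using assms(2) m by (simp add: \<epsilon>_def)
  have mm: "m * cnj m = complex_of_real ((cmod m)\<^sup>2)" "m + cnj m = complex_of_real (2 * Re m)"
    by (simp_all only: complex_norm_square complex_add_cnj)
  have "(1 - cscale m x) * (1 - cscale (cnj m) x)
      = 1 - cscale (m + cnj m) x + cscale (m * cnj m) (x * x)"
    by (simp add: algebra_simps cscale_mult_left cscale_mult_right cscale_cscale cscale_add_left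
        cscale_diff_right)
  also have "\<dots> = 1 - (2 * Re m) *\<^sub>R x + (cmod m)\<^sup>2 *\<^sub>R (x * x)"
    by (simp only: mm cscale_of_real)
  also have "\<dots> = k * k + (1 - (Re m / cmod m)\<^sup>2) *\<^sub>R 1"
    using m by (simp add: k_def algebra_simps power2_eq_square flip: scaleR_add_left)
  also have "1 - (Re m / cmod m)\<^sup>2 = \<epsilon>"
  proof -
    have "(Re m)\<^sup>2 / (cmod m)\<^sup>2 + (Im m)\<^sup>2 / (cmod m)\<^sup>2 = (cmod m)\<^sup>2 / (cmod m)\<^sup>2"
      by (simp only: cmod_power2 add_divide_distrib)
    then show ?thesis using m by (simp add: \<epsilon>_def power_divide)
  qed
  finally have "two_sided_unit ((1 - cscale m x) * (1 - cscale (cnj m) x))"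
    using two_sided_unit_norm_positive_add[OF norm_positive_square[OF k] \<open>\<epsilon> > 0\<close>] by simp
  then show ?thesis
    by (rule two_sided_unit_factor)
      (simp add: algebra_simps cscale_mult_left cscale_mult_right cscale_cscale cscale_diff_right)
qed

text \<open>Let \<open>m\<close> be the least nonnegative number for which \<open>x + m\<close> is
  positive. If \<open>m > 0\<close>, then \<open>x + m\<close> is also invertible, hence bounded
  below by a positive constant, and \<open>m\<close> could be lowered.\<close>

lemma norm_positive_if_translates_units:
  fixes x :: "'a::cstar_algebra_1"
  assumes sa: "cstar x = x" and inv: "\<And>t. 0 < t \<Longrightarrow> two_sided_unit (x + t *\<^sub>R 1)"
  shows "norm_positive x"
proof -
  define T where "T = {t. 0 \<le> t \<and> norm_positive (x + t *\<^sub>R 1)}"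
  have "norm_positive (norm x *\<^sub>R 1 - (- x))"
    by (rule norm_positive_const_minus) (simp_all add: cstar_minus sa)
  then have "norm x \<in> T" by (simp add: T_def add.commute)
  then have "T \<noteq> {}" by auto
  have bdd: "bdd_below T" by (rule bdd_belowI[of _ 0]) (simp add: T_def)
  define m where "m = Inf T"
  have "0 \<le> m"
    unfolding m_def using \<open>T \<noteq> {}\<close> by (rule cInf_greatest) (simp add: T_def)
  have up: "norm_positive (x + u *\<^sub>R 1)" if u: "m < u" for u
  proof -
    obtain t where t: "t \<in> T" "t < u"
      using cInf_lessD[OF \<open>T \<noteq> {}\<close> u[unfolded m_def]] by auto
    have "norm_positive ((x + t *\<^sub>R 1) + (u - t) *\<^sub>R 1)"
      by (rule norm_positive_add[OF _ norm_positive_const]) (use t in \<open>auto simp: T_def\<close>)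
    then show ?thesis by (simp add: algebra_simps)
  qed
  have "norm_positive (x + m *\<^sub>R 1)"
  proof (rule norm_positive_LIMSEQ)
    show "norm_positive (x + (m + 1 / real (Suc n)) *\<^sub>R 1)" for n
      by (rule up) simp
    have "(\<lambda>n. m + 1 / real (Suc n)) \<longlonglongrightarrow> m + 0"
      by (intro tendsto_add tendsto_const LIMSEQ_Suc lim_1_over_n)
    then show "(\<lambda>n. x + (m + 1 / real (Suc n)) *\<^sub>R 1) \<longlonglongrightarrow> x + m *\<^sub>R 1"
      by (intro tendsto_intros) simp
  qed
  moreover have "m = 0"
  proof (rule ccontr)
    assume "m \<noteq> 0"
    with \<open>0 \<le> m\<close> have "0 < m" by simp
    obtain \<delta> where \<delta>: "0 < \<delta>" "norm_positive (x + m *\<^sub>R 1 - \<delta> *\<^sub>R 1)"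
      using norm_positive_unit_bounded_below \<open>norm_positive (x + m *\<^sub>R 1)\<close> inv[OF \<open>0 < m\<close>] by blast
    \<comment> \<open>The minimum keeps \<open>m - \<eta>\<close> nonnegative, as membership in
      \<open>T\<close> demands.\<close>
    define \<eta> where "\<eta> = min \<delta> m"
    have "norm_positive ((x + m *\<^sub>R 1 - \<delta> *\<^sub>R 1) + (\<delta> - \<eta>) *\<^sub>R 1)"
      by (rule norm_positive_add[OF _ norm_positive_const]) (use \<delta> in \<open>auto simp: \<eta>_def\<close>)
    then have "m - \<eta> \<in> T" by (simp add: T_def \<eta>_def algebra_simps)
    then have "m \<le> m - \<eta>" unfolding m_def using bdd by (rule cInf_lower)
    then show False using \<delta> \<open>0 < m\<close> by (simp add: \<eta>_def min_def split: if_splits)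
  qed
  ultimately show ?thesis by simp
qed

lemma cpositive_iff_norm_positive: "cpositive x \<longleftrightarrow> norm_positive x"
  for x :: "'a::cstar_algebra_1"
proof
  assume x: "cpositive x"
  show "norm_positive x"
  proof (rule norm_positive_if_translates_units)
    show "cstar x = x" using x by (simp add: cpositive_def)
    fix t :: real
    assume "0 < t"
    then have "complex_of_real (- t) \<notin> complex_of_real ` {0..}"
      by (auto simp del: of_real_minus)
    then have "complex_of_real (- t) \<notin> cspectrum x"
      using x by (auto simp: cpositive_def)
    then have "two_sided_unit (1 - cscale (inverse (complex_of_real (- t))) x)"
      using \<open>0 < t\<close> by (simp add: cspectrum_def quasi_invertible_iff)
    also have "inverse (complex_of_real (- t)) = complex_of_real (- 1 / t)"
      by (simp add: divide_inverse)
    finally have "two_sided_unit (t *\<^sub>R (1 - (- 1 / t) *\<^sub>R x))"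
      using \<open>0 < t\<close> unfolding cscale_of_real by (intro two_sided_unit_scaleR) auto
    then show "two_sided_unit (x + t *\<^sub>R 1)"
      using \<open>0 < t\<close> by (simp add: algebra_simps)
  qed
next
  assume x: "norm_positive x"
  have sa: "cstar x = x" using x by (rule norm_positive_self_adjoint)
  have "l \<in> complex_of_real ` {0..}" if l: "l \<in> cspectrum x" for l
  proof (rule ccontr)
    assume nl: "l \<notin> complex_of_real ` {0..}"
    then have "l \<noteq> 0" by (metis atLeast_iff imageI of_real_0 order_refl)
    then have "\<not> two_sided_unit (1 - cscale (inverse l) x)"
      using l by (simp add: cspectrum_def quasi_invertible_iff)
    then have "Im (inverse l) = 0"
      using two_sided_unit_one_minus_cscale[OF sa] by blast
    then have "l = complex_of_real (Re l)"
      using \<open>l \<noteq> 0\<close> by (auto simp: complex_eq_iff)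
    moreover from this nl have "Re l < 0" by (metis atLeast_iff imageI not_le)
    moreover have "1 - cscale (inverse (complex_of_real (Re l))) x = (- 1 / Re l) *\<^sub>R x + 1 *\<^sub>R 1"
      by (simp add: cscale_of_real divide_inverse flip: of_real_inverse)
    moreover have "two_sided_unit ((- 1 / Re l) *\<^sub>R x + 1 *\<^sub>R 1)"
      using x \<open>Re l < 0\<close> by (intro two_sided_unit_norm_positive_add norm_positive_scaleR) auto
    ultimately show False
      using \<open>\<not> two_sided_unit (1 - cscale (inverse l) x)\<close> by metis
  qed
  then show "cpositive x" using sa by (auto simp: cpositive_def)
qed

text \<open>Writing \<open>c = - z\<^sup>* z\<close>, the element \<open>z z\<^sup>*\<close> is positive, so \<open>1 + z z\<^sup>* / norm c\<close> is invertible, and then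
  so is \<open>1 - c / norm c\<close>.\<close>

lemma norm_positive_minus_cstar_mult_imp_0:
  fixes z :: "'a::cstar_algebra_1"
  assumes "norm_positive (- (cstar z * z))"
  shows "z = 0"
proof (rule ccontr)
  assume "z \<noteq> 0"
  define c where "c = - (cstar z * z)"
  have nc: "norm c > 0" using \<open>z \<noteq> 0\<close> by (simp add: c_def cstar_identity)
  \<comment> \<open>Twice the real part of \<open>z\<close> and, up to sign, twice its imaginary
    part. Half the sum of their squares is \<open>z * cstar z + cstar z * z\<close>, and adding
    \<open>c\<close> leaves \<open>z * cstar z\<close>.\<close>
  define a b where "a = z + cstar z" and "b = cscale \<i> (z - cstar z)"
  have sa: "cstar a = a" "cstar b = b"
    by (simp_all add: a_def b_def cstar_add cstar_cscale cstar_cstar cstar_diff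
        cscale_minus_left cscale_diff_right)
  have "norm_positive ((1 / 2) *\<^sub>R (a * a + b * b) + c)"
    using assms sa
    by (intro norm_positive_add norm_positive_scaleR norm_positive_square) (simp_all add: c_def)
  also have "(1 / 2) *\<^sub>R (a * a + b * b) = z * cstar z + cstar z * z"
  proof -
    have "b * b = - ((z - cstar z) * (z - cstar z))"
      by (simp add: b_def cscale_mult_left cscale_mult_right cscale_cscale cscale_minus_left cscale_one)
    then have "a * a + b * b = 2 *\<^sub>R (z * cstar z + cstar z * z)"
      by (simp add: a_def algebra_simps scaleR_2)
    then show ?thesis by simp
  qed
  finally have "norm_positive (z * cstar z)" by (simp add: c_def)
  then have "norm_positive ((1 / norm c) *\<^sub>R (z * cstar z))"
    using nc by (intro norm_positive_scaleR) auto
  then have "two_sided_unit (1 + ((1 / norm c) *\<^sub>R z) * cstar z)"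
    using two_sided_unit_norm_positive_add[of "(1 / norm c) *\<^sub>R (z * cstar z)" 1]
    by (simp add: add.commute)
  then have "two_sided_unit (1 + cstar z * ((1 / norm c) *\<^sub>R z))"
    by (rule two_sided_unit_one_plus_swap)
  also have "1 + cstar z * ((1 / norm c) *\<^sub>R z) = 1 *\<^sub>R 1 - (1 / norm c) *\<^sub>R c"
    by (simp add: c_def)
  finally have unit: "two_sided_unit (1 *\<^sub>R 1 - (1 / norm c) *\<^sub>R c)" .
  have pc: "norm_positive ((1 / norm c) *\<^sub>R c)"
    using assms nc unfolding c_def by (intro norm_positive_scaleR) auto
  then have "norm_positive (1 *\<^sub>R 1 - (1 / norm c) *\<^sub>R c)"
    using nc by (intro norm_positive_const_minus norm_positive_self_adjoint) auto
  \<comment> \<open>Being positive and invertible, \<open>1 - c / norm c\<close> stays above a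
    positive constant, which forces the normalized \<open>c\<close> to have norm less than
    1.\<close>
  then obtain \<delta> where \<delta>: "0 < \<delta>" "\<delta> \<le> 1" "norm_positive (1 *\<^sub>R 1 - (1 / norm c) *\<^sub>R c - \<delta> *\<^sub>R 1)"
    using norm_positive_unit_bounded_below unit by blast
  have "norm ((1 / norm c) *\<^sub>R c) \<le> 1 - \<delta>"
    using \<delta> pc by (intro norm_le_of_norm_positive) (simp_all add: algebra_simps)
  then show False using nc \<delta>(1) by simp
qed

text \<open>With \<open>h = y\<^sup>* y\<close> and \<open>s = \<bar>h\<bar>\<close>, apply the previous lemma to \<open>z = y b\<close> where \<open>b = s - h\<close>: there
  \<open>z\<^sup>* z = b h b = - s b\<^sup>2\<close>.\<close>

lemma norm_positive_cstar_mult: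
  fixes y :: "'a::cstar_algebra_1"
  shows "norm_positive (cstar y * y)"
proof -
  define h where "h = cstar y * y"
  have sa: "cstar h = h" by (simp add: h_def cstar_mult cstar_cstar)
  obtain s where s: "s * s = h * h" "norm_positive s"
    "\<And>y. y * (h * h) = (h * h) * y \<Longrightarrow> y * s = s * y"
    using norm_positive_square[OF sa] by (rule norm_positive_sqrt) blast
  \<comment> \<open>The root of \<open>s\<close> turns \<open>s * b * b\<close> into the square of
    the self-adjoint element \<open>r * b\<close>.\<close>
  obtain r where r: "r * r = s" "norm_positive r" "\<And>y. y * s = s * y \<Longrightarrow> y * r = r * y"
    using s(2) by (rule norm_positive_sqrt) blast
  have hs: "h * s = s * h" by (rule s(3)) (simp add: mult.assoc)
  define b where "b = s - h"
  have sab: "cstar b = b"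
    using s(2) by (simp add: b_def cstar_diff sa norm_positive_self_adjoint)
  have bs: "b * s = s * b" by (simp add: b_def algebra_simps hs)
  have br: "b * r = r * b" using bs by (rule r(3))
  have hb: "b * h = - (s * b)" by (simp add: b_def algebra_simps s(1))
  have rb: "cstar (r * b) = r * b"
    using r(2) by (simp add: cstar_mult sab norm_positive_self_adjoint br)
  have rbrb: "(r * b) * (r * b) = s * b * b"
    using br r(1) by (metis mult.assoc)
  define z where "z = y * b"
  have z: "cstar z * z = - (s * b * b)"
  proof -
    have "cstar z * z = b * h * b"
      by (simp add: z_def cstar_mult sab h_def mult.assoc)
    then show ?thesis by (simp add: hb)
  qed
  have "norm_positive (- (cstar z * z))"
    using norm_positive_square[OF rb] by (simp add: z rbrb)
  then have "z = 0" by (rule norm_positive_minus_cstar_mult_imp_0)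
  then have "(r * b) * (r * b) = 0" using z rbrb by simp
  then have "r * b = 0" using rb self_adjoint_square_eq_0 by blast
  then have "s * b = 0" by (metis r(1) mult.assoc mult_zero_right)
  moreover have "b * b = 2 *\<^sub>R (s * b)"
    by (simp add: b_def algebra_simps s(1) hs scaleR_2)
  ultimately have "b = 0" using sab self_adjoint_square_eq_0 by simp
  then show ?thesis using s(2) by (simp add: b_def h_def)
qed

lemma norm_positive_conjugate:
  assumes "norm_positive p"
  shows "norm_positive (cstar x * p * x)"
proof -
  obtain s where s: "s * s = p" "norm_positive s"
    using assms by (rule norm_positive_sqrt) blast
  then have "cstar x * p * x = cstar (s * x) * (s * x)"
    by (simp add: cstar_mult norm_positive_self_adjoint mult.assoc flip: s(1))
  then show ?thesis using norm_positive_cstar_mult by simp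
qed

section \<open>The unitization\<close>

text \<open>The pair stands for the formal sum of an algebra element and a scalar multiple of an
  adjoined unit.\<close>

datatype 'a unitization = Unitization (alg_part: 'a) (scalar_part: complex)

instantiation unitization :: (cstar_algebra) real_algebra_1
begin

definition "0 = Unitization 0 0"
definition "1 = Unitization 0 1"
definition "x + y = Unitization (alg_part x + alg_part y) (scalar_part x + scalar_part y)"
definition "x - y = Unitization (alg_part x - alg_part y) (scalar_part x - scalar_part y)"
definition "- x = Unitization (- alg_part x) (- scalar_part x)"
definition "scaleR r x = Unitization (r *\<^sub>R alg_part x) (r *\<^sub>R scalar_part x)"
definition "x * y = Unitization
  (alg_part x * alg_part y + cscale (scalar_part x) (alg_part y) + cscale (scalar_part y) (alg_part x))
  (scalar_part x * scalar_part y)"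

instance
  by standard
    (simp_all add: unitization.expand zero_unitization_def one_unitization_def plus_unitization_def
      minus_unitization_def uminus_unitization_def scaleR_unitization_def times_unitization_def
      algebra_simps cscale_add_left cscale_add_right cscale_cscale cscale_mult_left
      cscale_mult_right cscale_scaleR cscale_one flip: cscale_of_real scaleR_conv_of_real)

end

lemma alg_part_simps [simp]:
  "alg_part 0 = 0" "alg_part 1 = 0" "alg_part (x + y) = alg_part x + alg_part y"
  "alg_part (x - y) = alg_part x - alg_part y" "alg_part (- x) = - alg_part x"
  "alg_part (r *\<^sub>R x) = r *\<^sub>R alg_part x"
  "alg_part (x * y)
    = alg_part x * alg_part y + cscale (scalar_part x) (alg_part y) + cscale (scalar_part y) (alg_part x)"
  by (simp_all add: zero_unitization_def one_unitization_def plus_unitization_def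
      minus_unitization_def uminus_unitization_def scaleR_unitization_def times_unitization_def)

lemma scalar_part_simps [simp]:
  "scalar_part 0 = 0" "scalar_part 1 = 1" "scalar_part (x + y) = scalar_part x + scalar_part y"
  "scalar_part (x - y) = scalar_part x - scalar_part y" "scalar_part (- x) = - scalar_part x"
  "scalar_part (r *\<^sub>R x) = r *\<^sub>R scalar_part x"
  "scalar_part (x * y) = scalar_part x * scalar_part y"
  by (simp_all add: zero_unitization_def one_unitization_def plus_unitization_def
      minus_unitization_def uminus_unitization_def scaleR_unitization_def times_unitization_def)

text \<open>Left multiplication by an element of the unitization on the original algebra, which is
  an ideal in it; its operator norm enters the C*-norm.\<close>

definition unitization_action :: "'a::cstar_algebra unitization \<Rightarrow> 'a \<Rightarrow> 'a"
  where "unitization_action x v = alg_part x * v + cscale (scalar_part x) v"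

lemma bounded_linear_unitization_action: "bounded_linear (unitization_action x)"
  unfolding unitization_action_def
  by (intro bounded_linear_add bounded_linear_mult_right bounded_linear_cscale)

lemma unitization_action_simps:
  "unitization_action 0 v = 0" "unitization_action 1 v = v"
  "unitization_action (x + y) v = unitization_action x v + unitization_action y v"
  "unitization_action (r *\<^sub>R x) v = r *\<^sub>R unitization_action x v"
  "unitization_action (x * y) v = unitization_action x (unitization_action y v)"
  by (simp_all add: unitization_action_def algebra_simps cscale_add_left cscale_add_right
      cscale_cscale cscale_mult_left cscale_mult_right cscale_one scaleR_conv_of_real[where 'a = complex]
      flip: cscale_of_real)

text \<open>Taking the maximum with the modulus of the scalar part makes this a norm
  even if the algebra already has a unit.\<close>

instantiation unitization :: (cstar_algebra) real_normed_algebra_1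
begin

definition "norm x = max (cmod (scalar_part x)) (onorm (unitization_action x))"
definition "dist x y = norm (x - y)" for x y :: "'a unitization"
definition "sgn x = x /\<^sub>R norm x" for x :: "'a unitization"
definition [code del]:
  "(uniformity :: ('a unitization \<times> 'a unitization) filter)
    = (INF e\<in>{0<..}. principal {(x, y). dist x y < e})"
definition [code del]:
  "open (U :: 'a unitization set)
    \<longleftrightarrow> (\<forall>x\<in>U. eventually (\<lambda>(x', y). x' = x \<longrightarrow> y \<in> U) uniformity)"

instance
proof
  fix x y :: "'a unitization" and r :: real
  note bl = bounded_linear_unitization_action
  show "dist x y = norm (x - y)" "sgn x = x /\<^sub>R norm x"
    by (simp_all add: dist_unitization_def sgn_unitization_def)
  show "uniformity = (INF e\<in>{0<..}. principal {(x, y :: 'a unitization). dist x y < e})"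
    by (rule uniformity_unitization_def)
  show "open U \<longleftrightarrow> (\<forall>x\<in>U. eventually (\<lambda>(x', y). x' = x \<longrightarrow> y \<in> U) uniformity)"
    for U :: "'a unitization set"
    by (rule open_unitization_def)
  show "norm x = 0 \<longleftrightarrow> x = 0"
  proof
    assume "norm x = 0"
    then have x: "cmod (scalar_part x) \<le> 0" "onorm (unitization_action x) \<le> 0"
      by (simp_all add: norm_unitization_def max_def split: if_splits)
    then have "onorm (unitization_action x) = 0"
      using onorm_pos_le[OF bl, of x] by linarith
    \<comment> \<open>The scalar part vanishes, so this says \<open>a * cstar a = 0\<close> for the
      algebra part \<open>a\<close>, and the C*-identity gives \<open>a = 0\<close>.\<close>
    then have "unitization_action x (cstar (alg_part x)) = 0"
      using onorm[OF bl, of x "cstar (alg_part x)"] by simp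
    then have "alg_part x = 0"
      using x by (auto simp: unitization_action_def intro: mult_cstar_eq_0)
    then show "x = 0" using x by (simp add: unitization.expand)
  next
    assume "x = 0"
    then show "norm x = 0"
      by (simp add: norm_unitization_def unitization_action_simps(1)[abs_def] onorm_zero)
  qed
  show "norm (x + y) \<le> norm x + norm y"
  proof -
    have "onorm (unitization_action (x + y)) \<le> onorm (unitization_action x) + onorm (unitization_action y)"
      using onorm_triangle[OF bl bl, of x y] by (simp add: unitization_action_simps(3)[abs_def])
    moreover have "cmod (scalar_part (x + y)) \<le> cmod (scalar_part x) + cmod (scalar_part y)"
      by (simp add: norm_triangle_ineq)
    ultimately show ?thesis by (simp add: norm_unitization_def max_def)
  qed
  show "norm (r *\<^sub>R x) = \<bar>r\<bar> * norm x"
    using onorm_scaleR[OF bl, of r x]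
    by (simp add: norm_unitization_def unitization_action_simps(4)[abs_def] max_mult_distrib_left)
  show "norm (x * y) \<le> norm x * norm y"
  proof -
    have "onorm (unitization_action (x * y)) \<le> onorm (unitization_action x) * onorm (unitization_action y)"
      using onorm_compose[OF bl bl, of x y] by (simp add: unitization_action_simps(5)[abs_def] comp_def)
    also have "\<dots> \<le> norm x * norm y"
      by (intro mult_mono) (simp_all add: norm_unitization_def onorm_pos_le[OF bl] le_max_iff_disj)
    finally show ?thesis
      by (simp add: norm_unitization_def norm_mult mult_mono le_max_iff_disj)
  qed
  show "norm (1 :: 'a unitization) = 1"
    using onorm_id_le[where 'a = 'a]
    by (simp add: norm_unitization_def unitization_action_simps(2)[abs_def] max_def)
qed

end

lemma norm_scalar_part_le: "cmod (scalar_part x) \<le> norm x"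
  by (simp add: norm_unitization_def)

text \<open>Evaluating left multiplication by \<open>a\<close> at \<open>cstar a\<close> shows that
  its operator norm is at least \<open>norm a\<close>, so the embedding is isometric.\<close>

lemma norm_Unitization_0 [simp]: "norm (Unitization a 0) = norm a"
proof -
  have bl: "bounded_linear (\<lambda>v. a * v)" by (rule bounded_linear_mult_right)
  have "norm a \<le> onorm (\<lambda>v. a * v)"
  proof (cases "a = 0")
    case False
    have "norm a * norm a = norm (a * cstar a)" by (simp add: norm_mult_cstar)
    also have "\<dots> \<le> onorm (\<lambda>v. a * v) * norm (cstar a)" by (rule onorm[OF bl])
    finally show ?thesis using False by simp
  qed (simp add: onorm_zero)
  moreover have "onorm (\<lambda>v. a * v) \<le> norm a"
    by (rule onorm_bound) (simp_all add: norm_mult_ineq)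
  ultimately show ?thesis
    using onorm_pos_le[OF bl] by (simp add: norm_unitization_def unitization_action_def[abs_def])
qed

lemma norm_Unitization_scalar: "norm (Unitization (0::'a::cstar_algebra) l) = cmod l"
proof -
  have "onorm (\<lambda>v::'a. cscale l v) \<le> cmod l"
    by (rule onorm_bound) (simp_all add: norm_cscale)
  then show ?thesis
    by (simp add: norm_unitization_def unitization_action_def[abs_def] max_def)
qed

text \<open>Both components are thus continuous, which reduces completeness of the unitization to
  that of the algebra and of the complex numbers.\<close>

lemma norm_alg_part_le: "norm (alg_part x) \<le> 2 * norm x"
proof -
  have "Unitization (alg_part x) 0 = x - Unitization 0 (scalar_part x)"
    by (simp add: unitization.expand)
  then have "norm (alg_part x) \<le> norm x + cmod (scalar_part x)"
    by (metis norm_Unitization_0 norm_Unitization_scalar norm_triangle_ineq4)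
  then show ?thesis using norm_scalar_part_le[of x] by simp
qed

instance unitization :: (cstar_algebra) banach
proof
  fix X :: "nat \<Rightarrow> 'a unitization"
  assume X: "Cauchy X"
  have "bounded_linear (alg_part :: 'a unitization \<Rightarrow> 'a)"
    by (rule bounded_linear_intro[where K = 2]) (simp_all add: norm_alg_part_le mult.commute[of _ 2])
  then have "Cauchy (\<lambda>n. alg_part (X n))"
    using X by (rule bounded_linear.Cauchy)
  then obtain a where a: "(\<lambda>n. alg_part (X n)) \<longlonglongrightarrow> a"
    using Cauchy_convergent convergent_def by blast
  have "bounded_linear (scalar_part :: 'a unitization \<Rightarrow> complex)"
    by (rule bounded_linear_intro[where K = 1]) (simp_all add: norm_scalar_part_le)
  then have "Cauchy (\<lambda>n. scalar_part (X n))"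
    using X by (rule bounded_linear.Cauchy)
  then obtain l where l: "(\<lambda>n. scalar_part (X n)) \<longlonglongrightarrow> l"
    using Cauchy_convergent convergent_def by blast
  have "(\<lambda>n. X n - Unitization a l) \<longlonglongrightarrow> 0"
  proof (rule Lim_null_comparison)
    have "(\<lambda>n. norm (alg_part (X n) - a) + cmod (scalar_part (X n) - l)) \<longlonglongrightarrow> 0 + 0"
      using a l by (intro tendsto_add) (simp_all flip: tendsto_dist_iff dist_norm)
    then show "(\<lambda>n. norm (alg_part (X n) - a) + cmod (scalar_part (X n) - l)) \<longlonglongrightarrow> 0"
      by simp
    have "norm (X n - Unitization a l) \<le> norm (alg_part (X n) - a) + cmod (scalar_part (X n) - l)" for n
    proof -
      have "X n - Unitization a l = Unitization (alg_part (X n) - a) 0 + Unitization 0 (scalar_part (X n) - l)"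
        by (simp add: unitization.expand)
      then show ?thesis
        by (metis norm_Unitization_0 norm_Unitization_scalar norm_triangle_ineq)
    qed
    then show "\<forall>\<^sub>F n in sequentially. norm (X n - Unitization a l)
        \<le> norm (alg_part (X n) - a) + cmod (scalar_part (X n) - l)"
      by simp
  qed
  then show "convergent X"
    by (auto simp: convergent_def LIM_zero_iff)
qed

instantiation unitization :: (cstar_algebra) cstar_algebra
begin

definition "cscale c x = Unitization (cscale c (alg_part x)) (c * scalar_part x)"
definition "cstar x = Unitization (cstar (alg_part x)) (cnj (scalar_part x))"

instance
proof
  fix x y :: "'a unitization" and c d :: complex and r :: real
  show "cscale c (x + y) = cscale c x + cscale c y" "cscale (c + d) x = cscale c x + cscale d x"
    "cscale c (cscale d x) = cscale (c * d) x" "cscale 1 x = x"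
    "cscale (complex_of_real r) x = r *\<^sub>R x"
    "cscale c x * y = cscale c (x * y)" "x * cscale c y = cscale c (x * y)"
    by (simp_all add: unitization.expand cscale_unitization_def algebra_simps cscale_add_left
        cscale_add_right cscale_cscale cscale_one cscale_of_real
        scaleR_conv_of_real[where 'a = complex] cscale_mult_left cscale_mult_right)
  show "cstar (cstar x) = x" "cstar (x + y) = cstar x + cstar y"
    "cstar (cscale c x) = cscale (cnj c) (cstar x)" "cstar (x * y) = cstar y * cstar x"
    by (simp_all add: unitization.expand cscale_unitization_def cstar_unitization_def algebra_simps
        cstar_cstar cstar_add cstar_cscale cstar_mult)
  show "norm (cscale c x) = cmod c * norm x"
  proof -
    have le: "norm (cscale c x) \<le> cmod c * norm x" for c and x :: "'a unitization"
    proof -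
      have "cscale c x = Unitization 0 c * x"
        by (simp add: unitization.expand cscale_unitization_def)
      then show ?thesis
        by (metis norm_Unitization_scalar norm_mult_ineq)
    qed
    show ?thesis
    proof (cases "c = 0")
      case False
      have "norm x \<le> norm (cscale c x) / cmod c"
        using le[of "inverse c" "cscale c x"] False
        by (simp add: cscale_unitization_def cscale_cscale cscale_one norm_inverse divide_inverse
            mult.commute unitization.expand flip: mult.assoc)
      with False le[of c x] show ?thesis by (simp add: field_simps)
    qed (use le[of c x] in simp)
  qed
  define N where "N = (\<lambda>x :: 'a unitization. onorm (unitization_action x))"
  note bl = bounded_linear_unitization_action
  have N_nonneg: "0 \<le> N x" for x
    unfolding N_def by (rule onorm_pos_le[OF bl])
  \<comment> \<open>By the C*-identity in the algebra, the squared norm of \<open>x\<close> acting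
    on \<open>v\<close> is the norm of \<open>cstar v\<close> times the action of
    \<open>cstar x * x\<close> on \<open>v\<close>.\<close>
  have N_square_le: "N x * N x \<le> N (cstar x * x)" for x
  proof -
    have "norm (unitization_action x v) \<le> sqrt (N (cstar x * x)) * norm v" for v
    proof -
      let ?w = "unitization_action x v"
      have "cstar ?w * ?w = cstar v * unitization_action (cstar x * x) v"
        by (simp add: unitization_action_def cstar_unitization_def algebra_simps cstar_add cstar_mult
            cstar_cscale cscale_mult_left cscale_mult_right cscale_cscale cscale_add_right)
      then have "norm ?w * norm ?w \<le> norm v * norm (unitization_action (cstar x * x) v)"
        by (metis cstar_identity norm_cstar norm_mult_ineq)
      also have "\<dots> \<le> norm v * (N (cstar x * x) * norm v)"
        unfolding N_def by (intro mult_left_mono onorm[OF bl]) simp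
      finally have "(norm ?w)\<^sup>2 \<le> N (cstar x * x) * (norm v)\<^sup>2"
        by (simp add: power2_eq_square mult_ac)
      then have "sqrt ((norm ?w)\<^sup>2) \<le> sqrt (N (cstar x * x) * (norm v)\<^sup>2)"
        by (rule real_sqrt_le_mono)
      then show ?thesis by (simp add: real_sqrt_mult)
    qed
    then have "N x \<le> sqrt (N (cstar x * x))"
      using N_nonneg[of "cstar x * x"] unfolding N_def by (intro onorm_bound) simp_all
    then have "N x * N x \<le> sqrt (N (cstar x * x)) * sqrt (N (cstar x * x))"
      by (intro mult_mono) (simp_all add: N_nonneg)
    then show ?thesis by (simp add: N_nonneg)
  qed
  have N_mult_le: "N (x * y) \<le> N x * N y" for x y
    using onorm_compose[OF bl bl, of x y]
    by (simp add: N_def unitization_action_simps(5)[abs_def] comp_def)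
  have star: "cstar (cstar x) = x" for x :: "'a unitization"
    by (simp add: cstar_unitization_def cstar_cstar)
  have N_le_star: "N x \<le> N (cstar x)" for x
  proof (cases "N x = 0")
    case False
    have "N x * N x \<le> N (cstar x) * N x"
      using N_square_le[of x] N_mult_le[of "cstar x" x] by linarith
    with False N_nonneg[of x] show ?thesis by simp
  qed (simp add: N_nonneg)
  have "N (cstar x * x) = N x * N x"
    using N_square_le[of x] N_mult_le[of "cstar x" x] N_le_star[of x] N_le_star[of "cstar x"]
    by (simp add: star)
  moreover have "max (p * p) (q * q) = max p q * max p q" if "0 \<le> p" "0 \<le> q" for p q :: real
    using that mult_mono[of p q p q] mult_mono[of q p q p] by (auto simp: max_def)
  ultimately show "norm (cstar x * x) = norm x * norm x"
    using N_nonneg[of x]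
    by (simp add: norm_unitization_def N_def[symmetric] norm_mult cstar_unitization_def)
      (simp add: N_def)
qed

end

instance unitization :: (cstar_algebra) cstar_algebra_1 ..

section \<open>Positivity in arbitrary C*-algebras\<close>

lemma Unitization_0_simps:
  "Unitization (0::'a::cstar_algebra) 0 = 0"
  "Unitization (a + b) 0 = Unitization a 0 + Unitization (b::'a) 0"
  "Unitization (a - b) 0 = Unitization a 0 - Unitization b 0"
  "Unitization (- a) 0 = - Unitization a 0"
  "Unitization (r *\<^sub>R a) 0 = r *\<^sub>R Unitization a 0"
  "Unitization (cscale c a) 0 = cscale c (Unitization a 0)"
  "Unitization (a * b) 0 = Unitization a 0 * Unitization b 0"
  "Unitization (cstar a) 0 = cstar (Unitization a 0)"
  by (simp_all add: unitization.expand cscale_unitization_def cstar_unitization_def)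

text \<open>A quasi-inverse of an embedded element has scalar part 0 and so lies in the algebra.
  Hence the embedding preserves the spectrum, and positivity can be tested in the
  unitization.\<close>

lemma quasi_invertible_Unitization: "quasi_invertible (Unitization a 0) \<longleftrightarrow> quasi_invertible a"
proof
  assume "quasi_invertible (Unitization a 0)"
  then obtain y where y: "Unitization a 0 + y - Unitization a 0 * y = 0"
    "Unitization a 0 + y - y * Unitization a 0 = 0"
    unfolding quasi_invertible_def by blast
  have "scalar_part y = 0"
    using arg_cong[OF y(1), of scalar_part] by simp
  then have "a + alg_part y - a * alg_part y = 0" "a + alg_part y - alg_part y * a = 0"
    using arg_cong[OF y(1), of alg_part] arg_cong[OF y(2), of alg_part] by simp_all
  then show "quasi_invertible a" unfolding quasi_invertible_def by blast
next
  assume "quasi_invertible a"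
  then obtain y where "a + y - a * y = 0" "a + y - y * a = 0"
    unfolding quasi_invertible_def by blast
  then have "Unitization a 0 + Unitization y 0 - Unitization a 0 * Unitization y 0 = 0"
    "Unitization a 0 + Unitization y 0 - Unitization y 0 * Unitization a 0 = 0"
    by (simp_all flip: Unitization_0_simps)
  then show "quasi_invertible (Unitization a 0)" unfolding quasi_invertible_def by blast
qed

lemma cpositive_iff: "cpositive a \<longleftrightarrow> norm_positive (Unitization a 0)"
proof -
  have "cspectrum (Unitization a 0) = cspectrum a"
    by (simp add: cspectrum_def quasi_invertible_Unitization flip: Unitization_0_simps)
  then show ?thesis
    by (simp add: cpositive_def cpositive_iff_norm_positive[symmetric] cstar_unitization_def)
qed

lemma cpositive_self_adjoint: "cpositive a \<Longrightarrow> cstar a = a"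
  by (simp add: cpositive_def)

lemma cpositive_0 [simp]: "cpositive 0"
  by (simp add: cpositive_iff Unitization_0_simps)

lemma cpositive_add: "cpositive a \<Longrightarrow> cpositive b \<Longrightarrow> cpositive (a + b)"
  by (simp add: cpositive_iff Unitization_0_simps norm_positive_add)

lemma cpositive_sum: "(\<And>i. i \<in> I \<Longrightarrow> cpositive (f i)) \<Longrightarrow> cpositive (sum f I)"
  by (induction I rule: infinite_finite_induct) (simp_all add: cpositive_add)

lemma cpositive_scaleR: "cpositive a \<Longrightarrow> 0 \<le> r \<Longrightarrow> cpositive (r *\<^sub>R a)"
  by (simp add: cpositive_iff Unitization_0_simps norm_positive_scaleR)

lemma cpositive_mult: "cpositive a \<Longrightarrow> cpositive b \<Longrightarrow> a * b = b * a \<Longrightarrow> cpositive (a * b)"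
  by (metis cpositive_iff Unitization_0_simps(7) norm_positive_mult)

lemma cpositive_cstar_mult: "cpositive (cstar a * a)"
  by (simp add: cpositive_iff Unitization_0_simps norm_positive_cstar_mult)

lemma cpositive_mult_cstar: "cpositive (a * cstar a)"
  using cpositive_cstar_mult[of "cstar a"] by (simp add: cstar_cstar)

lemma cpositive_square: "cstar a = a \<Longrightarrow> cpositive (a * a)"
  using cpositive_cstar_mult[of a] by simp

lemma cpositive_conjugate: "cpositive p \<Longrightarrow> cpositive (cstar a * p * a)"
  by (simp add: cpositive_iff Unitization_0_simps norm_positive_conjugate)

lemma cpositive_antisym: "cpositive (a - b) \<Longrightarrow> cpositive (b - a) \<Longrightarrow> a = b"
  using norm_positive_antisym[of "Unitization (a - b) 0"] Unitization_0_simps(1)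
  by (metis Unitization_0_simps(4) cpositive_iff eq_iff_diff_eq_0 minus_diff_eq unitization.inject)

lemma cpositive_LIMSEQ:
  assumes "\<And>n. cpositive (X n)" "X \<longlonglongrightarrow> x"
  shows "cpositive x"
  unfolding cpositive_iff
proof (rule norm_positive_LIMSEQ)
  show "norm_positive (Unitization (X n) 0)" for n
    using assms(1) by (simp add: cpositive_iff)
  have "bounded_linear (\<lambda>a. Unitization a 0 :: 'a unitization)"
    by (rule bounded_linear_intro[where K = 1]) (simp_all add: Unitization_0_simps(2,5))
  then show "(\<lambda>n. Unitization (X n) 0) \<longlonglongrightarrow> Unitization x 0"
    using assms(2) by (rule bounded_linear.tendsto)
qed

text \<open>In the unitization \<open>p \<le> q \<le> norm q\<close>, and positive elements below a
  constant have norm at most that constant.\<close>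

lemma norm_mono_cpositive:
  assumes "cpositive p" "cpositive (q - p)"
  shows "norm p \<le> norm q"
proof -
  have "cpositive q" using cpositive_add[OF assms] by simp
  then have "norm_positive (norm q *\<^sub>R 1 - Unitization q 0)"
    by (intro norm_positive_const_minus norm_positive_self_adjoint) (simp_all flip: cpositive_iff)
  then have "norm_positive ((norm q *\<^sub>R 1 - Unitization q 0) + Unitization (q - p) 0)"
    using assms(2) by (intro norm_positive_add) (simp_all flip: cpositive_iff)
  then have "norm_positive (norm q *\<^sub>R 1 - Unitization p 0)"
    by (simp add: Unitization_0_simps)
  then have "norm (Unitization p 0) \<le> norm q"
    using assms(1) by (intro norm_le_of_norm_positive) (simp_all flip: cpositive_iff)
  then show ?thesis by simp
qed

section \<open>Units of the algebra and order bounds for the norm\<close>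

definition is_unity :: "'a::times \<Rightarrow> bool"
  where "is_unity e \<longleftrightarrow> (\<forall>x. e * x = x \<and> x * e = x)"

lemma unital_iff: "unital TYPE('a::cstar_algebra) \<longleftrightarrow> (\<exists>e::'a. is_unity e)"
  by (simp add: unital_def is_unity_def)

lemma is_unity_simps: "is_unity e \<Longrightarrow> e * x = x" "is_unity e \<Longrightarrow> x * e = x"
  by (simp_all add: is_unity_def)

lemma cstar_unity: "is_unity e \<Longrightarrow> cstar e = (e::'a::cstar_algebra)"
  by (metis cstar_cstar cstar_mult is_unity_def)

lemma cpositive_unity: "is_unity e \<Longrightarrow> cpositive (e::'a::cstar_algebra)"
  using cpositive_cstar_mult[of e] by (simp add: cstar_unity is_unity_simps)

text \<open>The second alternative is the zero algebra, whose unit is 0.\<close>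

lemma norm_unity_cases:
  fixes e :: "'a::cstar_algebra"
  assumes "is_unity e"
  shows "norm e = 1 \<or> (\<forall>x::'a. x = 0)"
proof (cases "e = 0")
  case True
  then show ?thesis using assms by (metis is_unity_simps(1) mult_zero_left)
next
  case False
  have "norm e * norm e = norm e * 1"
    using cstar_identity[of e] assms by (simp add: cstar_unity is_unity_simps)
  with False show ?thesis by (simp del: mult_1_right)
qed

lemma norm_unity_le: "is_unity e \<Longrightarrow> norm (e::'a::cstar_algebra) \<le> 1"
  using norm_unity_cases[of e] by (metis norm_zero order_refl zero_le_one)

text \<open>The adjoined unit differs from \<open>e\<close>; conjugating the positive element
  \<open>t - h\<close> of the unitization by \<open>e\<close> replaces it by
  \<open>e\<close>.\<close>

lemma cpositive_unity_minus:
  fixes e h :: "'a::cstar_algebra"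
  assumes e: "is_unity e" and h: "cstar h = h" "norm h \<le> t"
  shows "cpositive (t *\<^sub>R e - h)"
proof -
  have "norm_positive (t *\<^sub>R 1 - Unitization h 0)"
    using h by (intro norm_positive_const_minus) (simp_all flip: Unitization_0_simps)
  then have "norm_positive (cstar (Unitization e 0) * (t *\<^sub>R 1 - Unitization h 0) * Unitization e 0)"
    by (rule norm_positive_conjugate)
  also have "cstar (Unitization e 0) * (t *\<^sub>R 1 - Unitization h 0) * Unitization e 0
      = Unitization (t *\<^sub>R e - h) 0"
    using e by (simp add: algebra_simps cstar_unity is_unity_simps flip: Unitization_0_simps)
  finally show ?thesis by (simp add: cpositive_iff)
qed

lemma norm_le_iff_cpositive_unity_minus:
  fixes e p :: "'a::cstar_algebra"
  assumes "is_unity e" "cpositive p" "0 \<le> t"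
  shows "norm p \<le> t \<longleftrightarrow> cpositive (t *\<^sub>R e - p)"
proof
  assume "norm p \<le> t"
  then show "cpositive (t *\<^sub>R e - p)"
    using assms by (intro cpositive_unity_minus) (simp_all add: cpositive_self_adjoint)
next
  assume "cpositive (t *\<^sub>R e - p)"
  then have "norm p \<le> norm (t *\<^sub>R e)"
    using assms(2) by (intro norm_mono_cpositive)
  also have "\<dots> \<le> t"
    using norm_unity_le[OF assms(1)] assms(3) by (simp add: mult_left_le)
  finally show "norm p \<le> t" .
qed

section \<open>The Mazur--Ulam theorem\<close>

text \<open>Additivity gives the formula for rational \<open>r\<close>, and the set of all
  \<open>r\<close> satisfying it is closed.\<close>

lemma additive_continuous_imp_scaleR:
  fixes g :: "real \<Rightarrow> 'b::real_normed_vector"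
  assumes add: "\<And>r s. g (r + s) = g r + g s" and cont: "continuous_on UNIV g"
  shows "g r = r *\<^sub>R g 1"
proof -
  interpret additive g by standard (rule add)
  have nat: "g (real n * s) = real n *\<^sub>R g s" for n s
    by (induction n) (simp_all add: zero add algebra_simps)
  have int: "g (of_int m * s) = of_int m *\<^sub>R g s" for m s
    by (cases m rule: int_cases2) (simp_all add: nat minus)
  have "closed {r. g r = r *\<^sub>R g 1}"
    by (intro closed_Collect_eq cont continuous_intros)
  moreover have "\<rat> \<subseteq> {r. g r = r *\<^sub>R g 1}"
  proof
    fix q :: real
    assume "q \<in> \<rat>"
    then obtain a b where b: "b > 0" and q: "q = of_int a / of_int b"
      by (rule Rats_cases') blast
    have "of_int b *\<^sub>R g q = g (of_int b * q)" by (rule int[symmetric])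
    also have "\<dots> = of_int a *\<^sub>R g 1" using int[of a 1] b by (simp add: q)
    also have "\<dots> = of_int b *\<^sub>R (q *\<^sub>R g 1)" using b by (simp add: q)
    finally have "g q = q *\<^sub>R g 1" using b by (simp del: scaleR_scaleR)
    then show "q \<in> {r. g r = r *\<^sub>R g 1}" by simp
  qed
  ultimately have "closure \<rat> \<subseteq> {r. g r = r *\<^sub>R g 1}"
    by (simp add: closure_minimal)
  then show ?thesis by (auto simp: Rats_closure_real)
qed

text \<open>Vaisala's proof: composing with reflections in the midpoint doubles the displacement
  of the midpoint, which is nevertheless bounded for all isometries fixing the end points.\<close>

lemma isometry_fixes_midpoint:
  fixes g :: "'a::real_normed_vector \<Rightarrow> 'a"
  assumes V: "subspace V" "a \<in> V" "b \<in> V"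
    and bij: "bij_betw g V V" and iso: "\<And>x y. x \<in> V \<Longrightarrow> y \<in> V \<Longrightarrow> norm (g x - g y) = norm (x - y)"
    and ends: "g a = a" "g b = b"
  shows "g ((1/2) *\<^sub>R (a + b)) = (1/2) *\<^sub>R (a + b)"
proof -
  define z where "z = (1/2) *\<^sub>R (a + b)"
  have z: "z \<in> V" using V by (simp add: z_def subspace_add subspace_scale)
  have zz: "a + b = z + z" by (simp add: z_def flip: scaleR_2)
  define \<rho> where "\<rho> x = a + b - x" for x
  have \<rho>V: "\<rho> x \<in> V" if "x \<in> V" for x
    using that V by (simp add: \<rho>_def subspace_add subspace_diff)
  have \<rho>bij: "bij_betw \<rho> V V"
    by (rule bij_betw_byWitness[where f' = \<rho>]) (use \<rho>V in \<open>auto simp: \<rho>_def\<close>)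
  have \<rho>iso: "norm (\<rho> x - \<rho> y) = norm (x - y)" for x y
    by (simp add: \<rho>_def norm_minus_commute)
  have bound: "2 ^ n * norm (g z - z) \<le> 2 * norm (a - z)"
    if "bij_betw g V V" "\<And>x y. x \<in> V \<Longrightarrow> y \<in> V \<Longrightarrow> norm (g x - g y) = norm (x - y)" "g a = a" "g b = b"
    for n g
    using that
  proof (induction n arbitrary: g)
    case 0
    have "norm (g z - z) \<le> norm (g z - g a) + norm (a - z)"
      using norm_triangle_ineq[of "g z - g a" "a - z"] 0 by simp
    also have "norm (g z - g a) = norm (a - z)"
      using 0(2)[OF z V(2)] by (simp add: norm_minus_commute)
    finally show ?case by simp
  next
    case (Suc n)
    define g' where "g' = inv_into V g"
    have g'bij: "bij_betw g' V V" unfolding g'_def by (rule bij_betw_inv_into[OF Suc.prems(1)])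
    have g'V: "g' x \<in> V" if "x \<in> V" for x
      using g'bij that by (auto simp: bij_betw_def)
    have gg': "g (g' x) = x" if "x \<in> V" for x
      using Suc.prems(1) that by (simp add: g'_def bij_betw_inv_into_right)
    have g'g: "g' (g x) = x" if "x \<in> V" for x
      using Suc.prems(1) that by (simp add: g'_def bij_betw_inv_into_left)
    have gV: "g x \<in> V" if "x \<in> V" for x
      using Suc.prems(1) that by (auto simp: bij_betw_def)
    have g'iso: "norm (g' x - g' y) = norm (x - y)" if "x \<in> V" "y \<in> V" for x y
      using Suc.prems(2)[OF g'V[OF that(1)] g'V[OF that(2)]] that by (simp add: gg')
    define h where "h = \<rho> \<circ> g' \<circ> \<rho> \<circ> g"
    have "bij_betw h V V"
      unfolding h_def using Suc.prems(1) \<rho>bij g'bij by (intro bij_betw_trans)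
    moreover have "norm (h x - h y) = norm (x - y)" if "x \<in> V" "y \<in> V" for x y
      using that by (simp add: h_def \<rho>iso g'iso gV \<rho>V Suc.prems(2))
    moreover have "g' a = a" "g' b = b"
      using g'g V Suc.prems by metis+
    then have "h a = a" "h b = b"
      by (simp_all add: h_def Suc.prems \<rho>_def)
    ultimately have "2 ^ n * norm (h z - z) \<le> 2 * norm (a - z)"
      by (rule Suc.IH)
    moreover have "norm (h z - z) = 2 * norm (g z - z)"
    proof -
      have "h z - z = z - g' (\<rho> (g z))" by (simp add: h_def \<rho>_def zz)
      then have "norm (h z - z) = norm (g' (g z) - g' (\<rho> (g z)))" using z by (simp add: g'g)
      also have "\<dots> = norm (g z - \<rho> (g z))" using z by (simp add: g'iso gV \<rho>V)
      also have "g z - \<rho> (g z) = 2 *\<^sub>R (g z - z)" by (simp add: \<rho>_def zz scaleR_2)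
      finally show ?thesis by simp
    qed
    ultimately show ?case by simp
  qed
  have "g z = z"
  proof (rule ccontr)
    assume "g z \<noteq> z"
    then have "norm (g z - z) > 0" by simp
    then obtain n where "2 * norm (a - z) / norm (g z - z) < 2 ^ n"
      using real_arch_pow[of 2 "2 * norm (a - z) / norm (g z - z)"] by auto
    then show False
      using bound[OF bij iso ends, of n] \<open>norm (g z - z) > 0\<close> by (simp add: field_simps)
  qed
  then show ?thesis by (simp add: z_def)
qed

text \<open>Apply \<open>f\<close>, reflect in the midpoint of the images, go back by the inverse
  and reflect in the midpoint \<open>z\<close>. This isometry fixes \<open>a\<close> and
  \<open>b\<close>, hence \<open>z\<close>, so \<open>f z\<close> is fixed by the reflection in the
  midpoint of the images.\<close>

lemma Mazur_Ulam_midpoint: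
  fixes f :: "'a::real_normed_vector \<Rightarrow> 'b::real_normed_vector"
  assumes V: "subspace V" "a \<in> V" "b \<in> V" and W: "subspace W" and bij: "bij_betw f V W"
    and iso: "\<And>x y. x \<in> V \<Longrightarrow> y \<in> V \<Longrightarrow> norm (f x - f y) = norm (x - y)"
  shows "f ((1/2) *\<^sub>R (a + b)) = (1/2) *\<^sub>R (f a + f b)"
proof -
  define z where "z = (1/2) *\<^sub>R (a + b)"
  have z: "z \<in> V" using V by (simp add: z_def subspace_add subspace_scale)
  define \<rho> where "\<rho> x = a + b - x" for x
  define \<sigma> where "\<sigma> y = f a + f b - y" for y
  define f' where "f' = inv_into V f"
  have fW: "f x \<in> W" if "x \<in> V" for x
    using bij that by (auto simp: bij_betw_def)
  have f'bij: "bij_betw f' W V" unfolding f'_def by (rule bij_betw_inv_into[OF bij])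
  have f'V: "f' y \<in> V" if "y \<in> W" for y
    using f'bij that by (auto simp: bij_betw_def)
  have ff': "f (f' y) = y" if "y \<in> W" for y
    using bij that by (simp add: f'_def bij_betw_inv_into_right)
  have f'f: "f' (f x) = x" if "x \<in> V" for x
    using bij that by (simp add: f'_def bij_betw_inv_into_left)
  have f'iso: "norm (f' x - f' y) = norm (x - y)" if "x \<in> W" "y \<in> W" for x y
    using iso[OF f'V[OF that(1)] f'V[OF that(2)]] that by (simp add: ff')
  have \<rho>V: "\<rho> x \<in> V" if "x \<in> V" for x
    using that V by (simp add: \<rho>_def subspace_add subspace_diff)
  have \<rho>bij: "bij_betw \<rho> V V"
    by (rule bij_betw_byWitness[where f' = \<rho>]) (use \<rho>V in \<open>auto simp: \<rho>_def\<close>)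
  have \<sigma>W: "\<sigma> y \<in> W" if "y \<in> W" for y
    using that V W by (simp add: \<sigma>_def subspace_add subspace_diff fW)
  have \<sigma>bij: "bij_betw \<sigma> W W"
    by (rule bij_betw_byWitness[where f' = \<sigma>]) (use \<sigma>W in \<open>auto simp: \<sigma>_def\<close>)
  define h where "h = \<rho> \<circ> f' \<circ> \<sigma> \<circ> f"
  have "h ((1/2) *\<^sub>R (a + b)) = (1/2) *\<^sub>R (a + b)"
  proof (rule isometry_fixes_midpoint[OF V])
    show "bij_betw h V V"
      unfolding h_def using bij \<sigma>bij f'bij \<rho>bij by (intro bij_betw_trans)
    show "norm (h x - h y) = norm (x - y)" if "x \<in> V" "y \<in> V" for x y
    proof -
      have "norm (h x - h y) = norm (f' (\<sigma> (f x)) - f' (\<sigma> (f y)))"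
        by (simp add: h_def \<rho>_def norm_minus_commute)
      also have "\<dots> = norm (\<sigma> (f x) - \<sigma> (f y))"
        using that by (simp add: f'iso fW \<sigma>W)
      also have "\<dots> = norm (x - y)"
        using iso[OF that] by (simp add: \<sigma>_def norm_minus_commute)
      finally show ?thesis .
    qed
    show "h a = a" "h b = b"
      using V by (simp_all add: h_def \<rho>_def \<sigma>_def f'f)
  qed
  then have "h z = z" by (simp add: z_def)
  then have "f' (\<sigma> (f z)) = \<rho> z" by (simp add: h_def \<rho>_def algebra_simps)
  also have "\<rho> z = z" by (simp add: \<rho>_def z_def algebra_simps flip: scaleR_2)
  finally have "\<sigma> (f z) = f z" using ff'[of "\<sigma> (f z)"] fW[OF z] \<sigma>W by simp
  then have "f a + f b = 2 *\<^sub>R f z" by (simp add: \<sigma>_def algebra_simps scaleR_2)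
  then show ?thesis by (simp add: z_def)
qed

text \<open>Midpoints with 0 give halving and then additivity; Lipschitz continuity along lines
  gives real homogeneity. Subspaces are used because the self-adjoint elements do not form a
  type.\<close>

lemma Mazur_Ulam:
  fixes f :: "'a::real_normed_vector \<Rightarrow> 'b::real_normed_vector"
  assumes V: "subspace V" and W: "subspace W" and bij: "bij_betw f V W"
    and iso: "\<And>x y. x \<in> V \<Longrightarrow> y \<in> V \<Longrightarrow> norm (f x - f y) = norm (x - y)" and f0: "f 0 = 0"
  shows "\<And>x y. x \<in> V \<Longrightarrow> y \<in> V \<Longrightarrow> f (x + y) = f x + f y"
    and "\<And>r x. x \<in> V \<Longrightarrow> f (r *\<^sub>R x) = r *\<^sub>R f x"
proof -
  have half: "f ((1/2) *\<^sub>R x) = (1/2) *\<^sub>R f x" if "x \<in> V" for x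
    using Mazur_Ulam_midpoint[OF V that subspace_0[OF V] W bij iso] by (simp add: f0)
  show add: "f (x + y) = f x + f y" if "x \<in> V" "y \<in> V" for x y
    using Mazur_Ulam_midpoint[OF V that W bij iso] half[of "x + y"] that V
    by (simp add: subspace_add)
  show "f (r *\<^sub>R x) = r *\<^sub>R f x" if x: "x \<in> V" for r x
  proof -
    have "norm (f (s *\<^sub>R x) - f (t *\<^sub>R x)) = \<bar>s - t\<bar> * norm x" for s t
      using iso[of "s *\<^sub>R x" "t *\<^sub>R x"] x V
      by (simp add: subspace_scale flip: scaleR_diff_left)
    then have "(norm x)-lipschitz_on UNIV (\<lambda>r. f (r *\<^sub>R x))"
      by (intro lipschitz_onI) (simp_all add: dist_norm mult.commute)
    then have "continuous_on UNIV (\<lambda>r. f (r *\<^sub>R x))"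
      by (rule lipschitz_on_continuous_on)
    moreover have "f ((r + s) *\<^sub>R x) = f (r *\<^sub>R x) + f (s *\<^sub>R x)" for r s
      using add x V by (simp add: scaleR_add_left subspace_scale)
    ultimately show ?thesis
      using additive_continuous_imp_scaleR[of "\<lambda>r. f (r *\<^sub>R x)" r] by simp
  qed
qed

section \<open>Kadison's inequality\<close>

text \<open>The elements \<open>B k\<close> are the Bernstein polynomials of degree \<open>n\<close> evaluated at \<open>h\<close>.\<close>

lemma ex_Bernstein_family:
  fixes e h :: "'a::cstar_algebra"
  assumes e: "is_unity e" and h: "cpositive h" "cpositive (e - h)"
  shows "\<exists>B. (\<forall>k. cpositive (B k) \<and> B k * h = h * B k) \<and> (\<forall>k>n. B k = 0)
    \<and> (\<Sum>k\<le>n. B k) = e \<and> (\<Sum>k\<le>n. real k *\<^sub>R B k) = real n *\<^sub>R h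
    \<and> (\<Sum>k\<le>n. (real k)\<^sup>2 *\<^sub>R B k) = real n *\<^sub>R h + (real n * (real n - 1)) *\<^sub>R (h * h)"
proof (induction n)
  case 0
  then show ?case
    using e by (intro exI[of _ "\<lambda>k. if k = 0 then e else 0"]) (simp add: cpositive_unity is_unity_simps)
next
  case (Suc n)
  then obtain B where pos: "\<And>k. cpositive (B k)" and comm: "\<And>k. B k * h = h * B k"
    and B0: "\<And>k. k > n \<Longrightarrow> B k = 0"
    and S0: "(\<Sum>k\<le>n. B k) = e" and S1: "(\<Sum>k\<le>n. real k *\<^sub>R B k) = real n *\<^sub>R h"
    and S2: "(\<Sum>k\<le>n. (real k)\<^sup>2 *\<^sub>R B k) = real n *\<^sub>R h + (real n * (real n - 1)) *\<^sub>R (h * h)"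
    by blast
  \<comment> \<open>The Pascal-type recursion for Bernstein polynomials. The three sums are the
    moments of order 0, 1 and 2 of the binomial distribution with parameters \<open>n\<close> and
    \<open>h\<close>.\<close>
  define C where "C k = (case k of 0 \<Rightarrow> 0 | Suc j \<Rightarrow> h * B j) + (e - h) * B k" for k
  have sum: "(\<Sum>k\<le>Suc n. c k *\<^sub>R C k) = h * (\<Sum>k\<le>n. c (Suc k) *\<^sub>R B k) + (e - h) * (\<Sum>k\<le>n. c k *\<^sub>R B k)"
    for c :: "nat \<Rightarrow> real"
  proof -
    have "(\<Sum>k\<le>Suc n. c k *\<^sub>R C k)
        = (\<Sum>k\<le>Suc n. c k *\<^sub>R (case k of 0 \<Rightarrow> 0 | Suc j \<Rightarrow> h * B j)) + (\<Sum>k\<le>Suc n. c k *\<^sub>R ((e - h) * B k))"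
      by (simp only: C_def scaleR_add_right sum.distrib)
    also have "(\<Sum>k\<le>Suc n. c k *\<^sub>R (case k of 0 \<Rightarrow> 0 | Suc j \<Rightarrow> h * B j)) = (\<Sum>k\<le>n. c (Suc k) *\<^sub>R (h * B k))"
      by (subst sum.atMost_Suc_shift) simp
    also have "(\<Sum>k\<le>Suc n. c k *\<^sub>R ((e - h) * B k)) = (\<Sum>k\<le>n. c k *\<^sub>R ((e - h) * B k))"
      by (simp add: B0)
    finally show ?thesis by (simp add: sum_distrib_left)
  qed
  have "cpositive (h * B k)" for k
    using h(1) pos comm[of k] by (intro cpositive_mult) simp_all
  moreover have "cpositive ((e - h) * B k)" for k
    using h(2) pos comm[of k] e
    by (intro cpositive_mult) (simp_all add: algebra_simps is_unity_simps)
  ultimately have "cpositive (C k)" for k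
    unfolding C_def by (cases k) (simp_all add: cpositive_add)
  moreover have "C k * h = h * C k" for k
    using comm e by (simp add: C_def algebra_simps is_unity_simps split: nat.split)
  moreover have "C k = 0" if "k > Suc n" for k
    using that B0 by (simp add: C_def split: nat.split)
  moreover have "(\<Sum>k\<le>Suc n. C k) = e"
    using sum[of "\<lambda>_. 1"] e by (simp add: S0 is_unity_simps)
  moreover have "(\<Sum>k\<le>Suc n. real k *\<^sub>R C k) = real (Suc n) *\<^sub>R h"
    using sum[of real] e
    by (simp add: S0 S1 is_unity_simps scaleR_add_left sum.distrib algebra_simps del: sum.atMost_Suc)
  moreover have "(\<Sum>k\<le>Suc n. (real k)\<^sup>2 *\<^sub>R C k)
      = real (Suc n) *\<^sub>R h + (real (Suc n) * (real (Suc n) - 1)) *\<^sub>R (h * h)"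
  proof -
    have "(real (Suc k))\<^sup>2 = (real k)\<^sup>2 + 2 * real k + 1" for k
      by (simp add: power2_eq_square algebra_simps)
    then have eq: "(\<Sum>k\<le>n. (real (Suc k))\<^sup>2 *\<^sub>R B k)
        = (\<Sum>k\<le>n. (real k)\<^sup>2 *\<^sub>R B k) + 2 *\<^sub>R (\<Sum>k\<le>n. real k *\<^sub>R B k) + (\<Sum>k\<le>n. B k)"
      by (simp add: scaleR_add_left sum.distrib scaleR_sum_right)
    show ?thesis
      unfolding sum[of "\<lambda>k. (real k)\<^sup>2"] eq S0 S1 S2
      using e by (simp add: is_unity_simps algebra_simps) (simp flip: scaleR_add_left)
  qed
  ultimately show ?case by blast
qed

text \<open>With \<open>Q k = J (B k)\<close> and \<open>M = J h\<close>, the sum of the positive elements \<open>(k / n - M) (Q k) (k / n - M)\<close>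
  equals the sum of the \<open>(k / n)\<^sup>2 (Q k)\<close> minus \<open>M\<^sup>2\<close>, and the former sum tends to \<open>J (h\<^sup>2)\<close>.\<close>

lemma Kadison_inequality:
  fixes J :: "'a::cstar_algebra \<Rightarrow> 'b::cstar_algebra"
  assumes lin: "linear J" and pos: "\<And>x. cpositive x \<Longrightarrow> cpositive (J x)"
    and e: "is_unity e" and Je: "is_unity (J e)" and h: "cpositive h" "cpositive (e - h)"
  shows "cpositive (J (h * h) - J h * J h)"
proof (rule cpositive_LIMSEQ)
  interpret J: linear J by (rule lin)
  define M where "M = J h"
  have M: "cstar M = M" unfolding M_def using pos[OF h(1)] by (rule cpositive_self_adjoint)
  \<comment> \<open>The term that tends to 0 comes from the second moment, which after division by
    the square of \<open>n\<close> is
    \<open>(1 / n) *\<^sub>R J h + (1 - 1 / n) *\<^sub>R J (h * h)\<close>. The choice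
    \<open>n = Suc m\<close> avoids division by 0.\<close>
  show "cpositive (J (h * h) - J h * J h + (1 / real (Suc m)) *\<^sub>R (J h - J (h * h)))" for m
  proof -
    define n where "n = Suc m"
    have n: "real n > 0" by (simp add: n_def)
    obtain B where B: "\<And>k. cpositive (B k)"
      and S0: "(\<Sum>k\<le>n. B k) = e" and S1: "(\<Sum>k\<le>n. real k *\<^sub>R B k) = real n *\<^sub>R h"
      and S2: "(\<Sum>k\<le>n. (real k)\<^sup>2 *\<^sub>R B k) = real n *\<^sub>R h + (real n * (real n - 1)) *\<^sub>R (h * h)"
      using ex_Bernstein_family[OF e h, of n] by (elim exE conjE, intro that) simp_all
    define Q where "Q k = J (B k)" for k
    define T where "T k = (real k / real n) *\<^sub>R J e - M" for k
    have T: "cstar (T k) = T k" for k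
      by (simp add: T_def cstar_diff cstar_scaleR M cstar_unity[OF Je])
    have "cpositive (\<Sum>k\<le>n. cstar (T k) * Q k * T k)"
      unfolding Q_def by (intro cpositive_sum cpositive_conjugate pos B)
    also have "(\<Sum>k\<le>n. cstar (T k) * Q k * T k)
        = (\<Sum>k\<le>n. (1 / (real n)\<^sup>2) *\<^sub>R ((real k)\<^sup>2 *\<^sub>R Q k) - (1 / real n) *\<^sub>R ((real k *\<^sub>R Q k) * M)
            - (1 / real n) *\<^sub>R (M * (real k *\<^sub>R Q k)) + M * Q k * M)"
      unfolding T using Je
      by (intro sum.cong) (simp_all add: T_def algebra_simps is_unity_simps power2_eq_square)
    also have "\<dots> = (1 / (real n)\<^sup>2) *\<^sub>R (\<Sum>k\<le>n. (real k)\<^sup>2 *\<^sub>R Q k)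
        - (1 / real n) *\<^sub>R ((\<Sum>k\<le>n. real k *\<^sub>R Q k) * M)
        - (1 / real n) *\<^sub>R (M * (\<Sum>k\<le>n. real k *\<^sub>R Q k)) + M * (\<Sum>k\<le>n. Q k) * M"
      by (simp only: sum.distrib sum_subtractf sum_distrib_left sum_distrib_right scaleR_sum_right)
    also have "(\<Sum>k\<le>n. Q k) = J e"
      by (simp add: Q_def flip: S0 J.sum)
    also have "(\<Sum>k\<le>n. real k *\<^sub>R Q k) = real n *\<^sub>R M"
      by (simp add: Q_def M_def flip: J.scale J.sum S1)
    also have "(\<Sum>k\<le>n. (real k)\<^sup>2 *\<^sub>R Q k) = real n *\<^sub>R M + (real n * (real n - 1)) *\<^sub>R J (h * h)"
      by (simp add: Q_def M_def flip: J.scale J.sum J.add S2)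
    also have "(1 / (real n)\<^sup>2) *\<^sub>R (real n *\<^sub>R M + (real n * (real n - 1)) *\<^sub>R J (h * h))
        = (1 / real n) *\<^sub>R M + (1 - 1 / real n) *\<^sub>R J (h * h)"
    proof -
      have "1 / (real n)\<^sup>2 * real n = 1 / real n"
        "1 / (real n)\<^sup>2 * (real n * (real n - 1)) = 1 - 1 / real n"
        using n by (simp_all add: power2_eq_square field_simps)
      then show ?thesis by (simp only: scaleR_add_right scaleR_scaleR)
    qed
    finally have "cpositive ((1 / real n) *\<^sub>R M + (1 - 1 / real n) *\<^sub>R J (h * h) - M * M)"
      using n Je by (simp add: is_unity_simps)
    then show ?thesis by (simp add: M_def n_def algebra_simps)
  qed
  have "(\<lambda>m. J (h * h) - J h * J h + (1 / real (Suc m)) *\<^sub>R (J h - J (h * h)))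
      \<longlonglongrightarrow> J (h * h) - J h * J h + 0 *\<^sub>R (J h - J (h * h))"
    by (intro tendsto_intros LIMSEQ_Suc lim_1_over_n)
  then show "(\<lambda>m. J (h * h) - J h * J h + (1 / real (Suc m)) *\<^sub>R (J h - J (h * h)))
      \<longlonglongrightarrow> J (h * h) - J h * J h"
    by simp
qed

section \<open>The unit and the order in terms of norms of sums\<close>

lemma eq_0_if_cpositive_eq_0:
  assumes "\<And>p::'a::cstar_algebra. cpositive p \<Longrightarrow> p = 0"
  shows "(x::'a) = 0"
  using assms[OF cpositive_mult_cstar[of x]] by (rule mult_cstar_eq_0)

text \<open>In the unitization put \<open>F = 1 - E\<close>. If \<open>norm x \<le> 1\<close>, then \<open>C = F x x\<^sup>* F\<close> belongs to the algebra and
  \<open>E + C \<le> 1 - F + F\<^sup>2 \<le> 1\<close>, so the hypothesis forces \<open>C = 0\<close>, that is, \<open>F x = 0\<close>.\<close>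

lemma is_unity_if_norm_add:
  fixes E :: "'a::cstar_algebra"
  assumes E: "cpositive E" and norm: "\<And>C. cpositive C \<Longrightarrow> norm (E + C) = 1 + norm C"
  shows "is_unity E"
proof -
  define G where "G = Unitization E 0"
  define F where "F = 1 - G"
  have G: "norm_positive G" using E by (simp add: G_def cpositive_iff)
  have "norm E = 1" using norm[of 0] by simp
  then have F: "norm_positive F"
    using G norm_positive_const_minus[of G 1] by (simp add: F_def G_def norm_positive_self_adjoint)
  have FG: "norm_positive (F * G)"
    using F G by (rule norm_positive_mult) (simp add: F_def algebra_simps)
  have le1: "E * x = x" if x: "norm x \<le> 1" for x
  proof -
    \<comment> \<open>This is \<open>F\<close> times \<open>x\<close>, computed inside the
      algebra.\<close>
    define y where "y = x - E * x"
    define X where "X = Unitization (x * cstar x) 0"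
    have X: "cstar X = X" "norm X \<le> 1"
      using x by (simp_all add: X_def cstar_unitization_def cstar_mult cstar_cstar norm_mult_cstar mult_le_one)
    have FXF: "F * X * F = Unitization (y * cstar y) 0"
      using cpositive_self_adjoint[OF E]
      by (simp add: F_def G_def X_def y_def unitization.expand algebra_simps cstar_diff cstar_mult cscale_one)
    have "norm_positive (cstar F * (1 *\<^sub>R 1 - X) * F + F * G)"
      by (intro norm_positive_add norm_positive_conjugate norm_positive_const_minus X FG)
    also have "cstar F * (1 *\<^sub>R 1 - X) * F + F * G = 1 *\<^sub>R 1 - (G + F * X * F)"
    proof -
      have "F * F + F * G = F" by (simp add: F_def algebra_simps)
      then show ?thesis
        using norm_positive_self_adjoint[OF F] by (simp add: algebra_simps) (simp add: F_def)
    qed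
    finally have "norm_positive (1 *\<^sub>R 1 - Unitization (E + y * cstar y) 0)"
      by (simp only: FXF G_def Unitization_0_simps)
    then have "norm (Unitization (E + y * cstar y) 0) \<le> 1"
      using E by (intro norm_le_of_norm_positive)
        (simp_all add: cpositive_add cpositive_mult_cstar flip: cpositive_iff)
    then have "norm (y * cstar y) = 0"
      using norm[OF cpositive_mult_cstar[of y]] by simp
    then show "E * x = x" using mult_cstar_eq_0[of y] by (simp add: y_def)
  qed
  have left: "E * x = x" for x
  proof (cases "x = 0")
    case False
    have "E * ((1 / norm x) *\<^sub>R x) = (1 / norm x) *\<^sub>R x"
      using False by (intro le1) simp
    with False show ?thesis by simp
  qed simp
  then have "x * E = x" for x
    by (metis cpositive_self_adjoint[OF E] cstar_cstar cstar_mult)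
  with left show ?thesis by (simp add: is_unity_def)
qed

text \<open>For the lower bound let \<open>u\<close> be the norm of the sum:
  \<open>t f + p \<le> u f\<close> gives \<open>p \<le> (u - t) f\<close>. The case
  \<open>t = 1\<close> is the property by which \<open>is_unity_if_norm_add\<close> recognizes the
  unit.\<close>

lemma norm_unity_plus_cpositive:
  fixes f p :: "'a::cstar_algebra"
  assumes f: "is_unity f" "norm f = 1" and p: "cpositive p" and "0 \<le> t"
  shows "norm (t *\<^sub>R f + p) = t + norm p"
proof (rule antisym)
  show "norm (t *\<^sub>R f + p) \<le> t + norm p"
    using norm_triangle_ineq[of "t *\<^sub>R f" p] \<open>0 \<le> t\<close> f(2) by simp
  define u where "u = norm (t *\<^sub>R f + p)"
  have tf: "cpositive (t *\<^sub>R f)"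
    using f \<open>0 \<le> t\<close> by (simp add: cpositive_scaleR cpositive_unity)
  have "norm (t *\<^sub>R f) \<le> u"
    unfolding u_def using tf p by (intro norm_mono_cpositive) simp_all
  then have "t \<le> u" using \<open>0 \<le> t\<close> f(2) by simp
  have "cpositive (u *\<^sub>R f - (t *\<^sub>R f + p))"
    using norm_le_iff_cpositive_unity_minus[OF f(1), of "t *\<^sub>R f + p" u] tf p
    by (simp add: u_def cpositive_add)
  then have "cpositive ((u - t) *\<^sub>R f - p)" by (simp add: algebra_simps)
  then have "norm p \<le> u - t"
    using norm_le_iff_cpositive_unity_minus[OF f(1) p, of "u - t"] \<open>t \<le> u\<close> by simp
  then show "t + norm p \<le> norm (t *\<^sub>R f + p)" by (simp add: u_def)
qed

lemma cpositive_diff_if_norm_add_le: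
  fixes a b e :: "'a::cstar_algebra"
  assumes e: "is_unity e" and a: "cpositive a" and b: "cpositive b"
    and le: "\<And>c. cpositive c \<Longrightarrow> norm (a + c) \<le> norm (b + c)"
  shows "cpositive (b - a)"
proof -
  have c: "cpositive (norm b *\<^sub>R e - b)"
    using norm_le_iff_cpositive_unity_minus[OF e b, of "norm b"] by simp
  have "norm (a + (norm b *\<^sub>R e - b)) \<le> norm (b + (norm b *\<^sub>R e - b))"
    using c by (rule le)
  also have "\<dots> \<le> norm b"
    using norm_unity_le[OF e] by (simp add: mult_left_le)
  finally have "cpositive (norm b *\<^sub>R e - (a + (norm b *\<^sub>R e - b)))"
    using norm_le_iff_cpositive_unity_minus[OF e, of "a + (norm b *\<^sub>R e - b)" "norm b"] a c
    by (simp add: cpositive_add)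
  then show ?thesis by simp
qed

text \<open>For the converse, \<open>s e - h\<close> and \<open>s e + h\<close> commute, so their
  product \<open>(s * s) e - h * h\<close> is positive and bounds the norm of
  \<open>h * h\<close>.\<close>

lemma norm_le_iff_unity_bounds:
  fixes e h :: "'a::cstar_algebra"
  assumes e: "is_unity e" and h: "cstar h = h" and "0 \<le> s"
  shows "norm h \<le> s \<longleftrightarrow> cpositive (s *\<^sub>R e - h) \<and> cpositive (s *\<^sub>R e + h)"
proof
  assume "norm h \<le> s"
  then show "cpositive (s *\<^sub>R e - h) \<and> cpositive (s *\<^sub>R e + h)"
    using cpositive_unity_minus[OF e h] cpositive_unity_minus[OF e, of "- h" s] h
    by (simp add: cstar_minus)
next
  assume *: "cpositive (s *\<^sub>R e - h) \<and> cpositive (s *\<^sub>R e + h)"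
  then have "cpositive ((s *\<^sub>R e - h) * (s *\<^sub>R e + h))"
    using e by (intro cpositive_mult) (simp_all add: algebra_simps is_unity_simps)
  also have "(s *\<^sub>R e - h) * (s *\<^sub>R e + h) = (s * s) *\<^sub>R e - h * h"
    using e by (simp add: algebra_simps is_unity_simps)
  finally have "norm (h * h) \<le> s * s"
    using norm_le_iff_cpositive_unity_minus[OF e cpositive_square[OF h], of "s * s"] by simp
  then show "norm h \<le> s"
    using \<open>0 \<le> s\<close> abs_le_square_iff[of "norm h" s] norm_self_adjoint_square[OF h]
    by (simp add: power2_eq_square)
qed

lemma is_unity_unique: "is_unity e \<Longrightarrow> is_unity e' \<Longrightarrow> e = e'"
  by (metis is_unity_def)

text \<open>The norm of \<open>E / t + C\<close> is computed through \<phi> as the norm of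
  \<open>t f\<close> plus a positive element, divided by \<open>t\<close>, which gives the norm
  characterization of the unit. General \<open>t\<close> is treated because homogeneity of \<phi> is
  not yet available.\<close>

lemma is_unity_preimage:
  fixes \<phi> :: "'a::cstar_algebra \<Rightarrow> 'b::cstar_algebra"
  assumes pos: "\<And>a. cpositive a \<Longrightarrow> cpositive (\<phi> a)"
    and norm: "\<And>a b. cpositive a \<Longrightarrow> cpositive b \<Longrightarrow> norm (\<phi> a + \<phi> b) = norm (a + b)"
    and f: "is_unity f" and E: "cpositive E" "\<phi> E = t *\<^sub>R f" and t: "0 < t"
  shows "is_unity ((1 / t) *\<^sub>R E)"
proof -
  have n: "norm (\<phi> a) = norm a" if "cpositive a" for a
    using norm[OF that that] by (simp flip: scaleR_2)
  show ?thesis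
    using norm_unity_cases[OF f]
  proof
    assume "\<forall>x::'b. x = 0"
    then have "norm a = 0" if "cpositive a" for a :: 'a
      using n[OF that] by (metis norm_zero)
    then have "x = 0" for x :: 'a
      using eq_0_if_cpositive_eq_0[where 'a = 'a] by simp
    then show ?thesis unfolding is_unity_def by metis
  next
    assume f1: "norm f = 1"
    show ?thesis
    proof (rule is_unity_if_norm_add)
      show "cpositive ((1 / t) *\<^sub>R E)" using E t by (simp add: cpositive_scaleR)
      fix C :: 'a
      assume C: "cpositive C"
      then have tC: "cpositive (t *\<^sub>R C)" using t by (simp add: cpositive_scaleR)
      have "(1 / t) *\<^sub>R E + C = (1 / t) *\<^sub>R (E + t *\<^sub>R C)"
        using t by (simp add: algebra_simps)
      then have "norm ((1 / t) *\<^sub>R E + C) = norm (E + t *\<^sub>R C) / t"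
        using t by simp
      also have "norm (E + t *\<^sub>R C) = norm (t *\<^sub>R f + \<phi> (t *\<^sub>R C))"
        using norm[OF E(1) tC] by (simp add: E)
      also have "\<dots> = t + t * norm C"
        using norm_unity_plus_cpositive[OF f f1 pos[OF tC], of t] t by (simp add: n[OF tC])
      finally show "norm ((1 / t) *\<^sub>R E + C) = 1 + norm C"
        using t by (simp add: add_divide_distrib)
    qed
  qed
qed

section \<open>Real and imaginary parts\<close>

definition re_part :: "'a::cstar_algebra \<Rightarrow> 'a"
  where "re_part x = (1 / 2) *\<^sub>R (x + cstar x)"

definition im_part :: "'a::cstar_algebra \<Rightarrow> 'a"
  where "im_part x = cscale (- \<i>) ((1 / 2) *\<^sub>R (x - cstar x))"

lemma cstar_re_part [simp]: "cstar (re_part x) = re_part x"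
  by (simp add: re_part_def cstar_scaleR cstar_add cstar_cstar add.commute)

lemma cstar_im_part [simp]: "cstar (im_part x) = im_part x"
  by (simp add: im_part_def cstar_scaleR cstar_diff cstar_cstar cstar_cscale cscale_minus_left
      cscale_diff_right cscale_scaleR scaleR_diff_right)

lemma re_im_part_eq: "re_part x + cscale \<i> (im_part x) = x"
  by (simp add: re_part_def im_part_def cscale_cscale cscale_one flip: scaleR_add_right scaleR_2)

lemma re_im_part_unique:
  assumes "cstar h = h" "cstar k = k"
  shows "re_part (h + cscale \<i> k) = h" "im_part (h + cscale \<i> k) = k"
proof -
  have "cstar (h + cscale \<i> k) = h - cscale \<i> k"
    by (simp add: cstar_add cstar_cscale assms cscale_minus_left)
  then show "re_part (h + cscale \<i> k) = h" "im_part (h + cscale \<i> k) = k"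
    by (simp_all add: re_part_def im_part_def cscale_cscale cscale_one flip: scaleR_2)
qed

lemma re_im_part_add:
  "re_part (x + y) = re_part x + re_part y" "im_part (x + y) = im_part x + im_part y"
  by (simp_all add: re_part_def im_part_def cstar_add algebra_simps cscale_add_right cscale_diff_right)

lemma re_im_part_self_adjoint:
  assumes "cstar h = h"
  shows "re_part h = h" "im_part h = 0"
  using re_im_part_unique[OF assms, of 0] by simp_all

lemma re_im_part_cscale:
  "re_part (cscale c x) = Re c *\<^sub>R re_part x - Im c *\<^sub>R im_part x"
  "im_part (cscale c x) = Re c *\<^sub>R im_part x + Im c *\<^sub>R re_part x"
proof -
  have "cscale c x = cscale (of_real (Re c) + \<i> * of_real (Im c)) (re_part x + cscale \<i> (im_part x))"
    by (simp add: re_im_part_eq flip: complex_eq)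
  also have "\<dots> = (Re c *\<^sub>R re_part x - Im c *\<^sub>R im_part x)
      + cscale \<i> (Re c *\<^sub>R im_part x + Im c *\<^sub>R re_part x)"
    by (simp add: cscale_add_left cscale_add_right cscale_of_real cscale_minus_left cscale_scaleR
        algebra_simps flip: cscale_cscale) (simp add: cscale_cscale cscale_minus_left cscale_one)
  finally have *: "cscale c x = \<dots>" .
  show "re_part (cscale c x) = Re c *\<^sub>R re_part x - Im c *\<^sub>R im_part x"
    "im_part (cscale c x) = Re c *\<^sub>R im_part x + Im c *\<^sub>R re_part x"
    unfolding * by (rule re_im_part_unique; simp add: cstar_add cstar_diff cstar_scaleR)+
qed

lemma re_im_part_cstar: "re_part (cstar x) = re_part x" "im_part (cstar x) = - im_part x"
  by (simp_all add: re_part_def im_part_def cstar_cstar add.commute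
      flip: cscale_minus_right scaleR_minus_right)

section \<open>Extending the map to a Jordan isomorphism\<close>

text \<open>The two maps are inverse to each other on the cones only. By \<open>inverse\<close>
  below the situation is symmetric, so each result also applies to \<psi>.\<close>

locale norm_additive_bijection =
  fixes \<phi> :: "'a::cstar_algebra \<Rightarrow> 'b::cstar_algebra" and \<psi> :: "'b \<Rightarrow> 'a" and e :: 'a and f :: 'b
  assumes e: "is_unity e" and f: "is_unity f"
    and pos: "cpositive a \<Longrightarrow> cpositive (\<phi> a)" and pos': "cpositive b \<Longrightarrow> cpositive (\<psi> b)"
    and left: "cpositive a \<Longrightarrow> \<psi> (\<phi> a) = a" and right: "cpositive b \<Longrightarrow> \<phi> (\<psi> b) = b"
    and norm_add: "cpositive a \<Longrightarrow> cpositive c \<Longrightarrow> norm (\<phi> a + \<phi> c) = norm (a + c)"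
begin

lemma inverse: "norm_additive_bijection \<psi> \<phi> f e"
proof
  fix b d :: 'b
  assume "cpositive b" "cpositive d"
  then show "norm (\<psi> b + \<psi> d) = norm (b + d)"
    using norm_add[OF pos' pos', of b d] by (simp add: right)
qed (simp_all add: e f pos pos' left right)

lemma norm_eq: "cpositive a \<Longrightarrow> norm (\<phi> a) = norm a"
  using norm_add[of a a] by (simp flip: scaleR_2)

text \<open>Every positive \<open>c\<close> in the target is an image, so norms of sums with
  \<open>c\<close> can be compared in the source, where the norm is monotone.\<close>

lemma mono:
  assumes "cpositive a" "cpositive b" "cpositive (b - a)"
  shows "cpositive (\<phi> b - \<phi> a)"
proof (rule cpositive_diff_if_norm_add_le[OF f pos pos])
  fix c :: 'b
  assume c: "cpositive c"
  have "norm (\<phi> a + c) = norm (a + \<psi> c)"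
    using norm_add[of a "\<psi> c"] assms c by (simp add: right pos')
  also have "\<dots> \<le> norm (b + \<psi> c)"
    using assms c by (intro norm_mono_cpositive) (simp_all add: cpositive_add pos')
  also have "\<dots> = norm (\<phi> b + c)"
    using norm_add[of b "\<psi> c"] assms c by (simp add: right pos')
  finally show "norm (\<phi> a + c) \<le> norm (\<phi> b + c)" .
qed (use assms in auto)

lemma scaleR_unity:
  assumes "0 \<le> t"
  shows "\<phi> (t *\<^sub>R e) = t *\<^sub>R f"
proof (cases "t = 0")
  case True
  then show ?thesis using norm_eq[of 0] by simp
next
  case False
  with assms have t: "0 < t" by simp
  have te: "cpositive (t *\<^sub>R e)" using e t by (simp add: cpositive_scaleR cpositive_unity)
  interpret inv: norm_additive_bijection \<psi> \<phi> f e by (rule inverse)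
  have "is_unity ((1 / t) *\<^sub>R \<phi> (t *\<^sub>R e))"
    using is_unity_preimage[OF inv.pos inv.norm_add e pos[OF te] left[OF te] t] by simp
  then have "(1 / t) *\<^sub>R \<phi> (t *\<^sub>R e) = f" using f by (rule is_unity_unique)
  then show ?thesis using t by (metis divide_inverse mult_1 right_inverse less_irrefl scaleR_one scaleR_scaleR)
qed

lemma plus_complement_le:
  assumes a: "cpositive a" "norm a \<le> t"
  shows "cpositive (t *\<^sub>R f - \<phi> a - \<phi> (t *\<^sub>R e - a))"
proof -
  have t: "0 \<le> t" using a(2) norm_ge_zero order_trans by blast
  have c: "cpositive (t *\<^sub>R e - a)"
    using norm_le_iff_cpositive_unity_minus[OF e a(1) t] a(2) by simp
  have "norm (\<phi> a + \<phi> (t *\<^sub>R e - a)) = norm (t *\<^sub>R e)"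
    using norm_add[OF a(1) c] by simp
  also have "\<dots> \<le> t" using norm_unity_le[OF e] t by (simp add: mult_left_le)
  finally have "cpositive (t *\<^sub>R f - (\<phi> a + \<phi> (t *\<^sub>R e - a)))"
    using norm_le_iff_cpositive_unity_minus[OF f cpositive_add[OF pos[OF a(1)] pos[OF c]] t] by simp
  then show ?thesis by (simp add: algebra_simps)
qed

text \<open>One inequality is \<open>plus_complement_le\<close>. The same lemma for \<psi> at
  \<open>\<phi> a\<close> gives \<open>\<psi> (t f - \<phi> a) \<le> t e - a\<close>, and applying
  the monotone \<phi> yields the other.\<close>

lemma complement:
  assumes a: "cpositive a" "norm a \<le> t"
  shows "\<phi> (t *\<^sub>R e - a) = t *\<^sub>R f - \<phi> a"
proof (rule cpositive_antisym)
  show "cpositive (t *\<^sub>R f - \<phi> a - \<phi> (t *\<^sub>R e - a))" using a by (rule plus_complement_le)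
  interpret inv: norm_additive_bijection \<psi> \<phi> f e by (rule inverse)
  have t: "0 \<le> t" using a(2) norm_ge_zero order_trans by blast
  have c: "cpositive (t *\<^sub>R e - a)" "cpositive (t *\<^sub>R f - \<phi> a)"
    using norm_le_iff_cpositive_unity_minus[OF e a(1) t] a(2)
      norm_le_iff_cpositive_unity_minus[OF f pos[OF a(1)] t] norm_eq[OF a(1)] by simp_all
  have "cpositive (t *\<^sub>R e - a - \<psi> (t *\<^sub>R f - \<phi> a))"
    using inv.plus_complement_le[OF pos[OF a(1)], of t] a by (simp add: norm_eq left)
  then have "cpositive (\<phi> (t *\<^sub>R e - a) - \<phi> (\<psi> (t *\<^sub>R f - \<phi> a)))"
    using c by (intro mono pos')
  then show "cpositive (\<phi> (t *\<^sub>R e - a) - (t *\<^sub>R f - \<phi> a))"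
    using c by (simp add: right)
qed

text \<open>\<open>a - b \<le> s\<close> means that the sum of the positive elements
  \<open>a\<close> and \<open>t - b\<close> has norm at most \<open>t + s\<close>; \<phi> preserves
  this norm and maps \<open>t - b\<close> to \<open>t - \<phi> b\<close>.\<close>

lemma diff_le_iff:
  assumes a: "cpositive a" and b: "cpositive b"
  shows "cpositive (s *\<^sub>R f - (\<phi> a - \<phi> b)) \<longleftrightarrow> cpositive (s *\<^sub>R e - (a - b))"
proof -
  \<comment> \<open>Large enough for \<open>t - b\<close> to be positive and for
    \<open>t + s\<close> to be nonnegative even when \<open>s < 0\<close>.\<close>
  define t where "t = norm b + \<bar>s\<bar>"
  have t: "norm b \<le> t" "0 \<le> t" "0 \<le> t + s" by (simp_all add: t_def add_nonneg_nonneg abs_real_def)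
  have c: "cpositive (t *\<^sub>R e - b)"
    using norm_le_iff_cpositive_unity_minus[OF e b] t by simp
  have ac: "cpositive (a + (t *\<^sub>R e - b))" "cpositive (\<phi> a + \<phi> (t *\<^sub>R e - b))"
    using a c by (simp_all add: cpositive_add pos)
  have "cpositive ((t + s) *\<^sub>R f - (\<phi> a + \<phi> (t *\<^sub>R e - b))) \<longleftrightarrow> norm (\<phi> a + \<phi> (t *\<^sub>R e - b)) \<le> t + s"
    by (rule norm_le_iff_cpositive_unity_minus[OF f ac(2) t(3), symmetric])
  also have "\<dots> \<longleftrightarrow> norm (a + (t *\<^sub>R e - b)) \<le> t + s"
    using norm_add[OF a c] by simp
  also have "\<dots> \<longleftrightarrow> cpositive ((t + s) *\<^sub>R e - (a + (t *\<^sub>R e - b)))"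
    by (rule norm_le_iff_cpositive_unity_minus[OF e ac(1) t(3)])
  finally show ?thesis
    by (simp add: complement[OF b t(1)] algebra_simps)
qed

lemma norm_diff:
  assumes a: "cpositive a" and b: "cpositive b"
  shows "norm (\<phi> a - \<phi> b) = norm (a - b)"
proof -
  have iff: "norm (\<phi> a - \<phi> b) \<le> s \<longleftrightarrow> norm (a - b) \<le> s" if s: "0 \<le> s" for s
  proof -
    have "norm (\<phi> a - \<phi> b) \<le> s \<longleftrightarrow> cpositive (s *\<^sub>R f - (\<phi> a - \<phi> b)) \<and> cpositive (s *\<^sub>R f - (\<phi> b - \<phi> a))"
      using norm_le_iff_unity_bounds[OF f _ s, of "\<phi> a - \<phi> b"] a b
      by (simp add: cstar_diff cpositive_self_adjoint pos algebra_simps)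
    also have "\<dots> \<longleftrightarrow> cpositive (s *\<^sub>R e - (a - b)) \<and> cpositive (s *\<^sub>R e - (b - a))"
      using diff_le_iff a b by simp
    also have "\<dots> \<longleftrightarrow> norm (a - b) \<le> s"
      using norm_le_iff_unity_bounds[OF e _ s, of "a - b"] a b
      by (simp add: cstar_diff cpositive_self_adjoint algebra_simps)
    finally show ?thesis .
  qed
  show ?thesis
    using iff[of "norm (\<phi> a - \<phi> b)"] iff[of "norm (a - b)"] by (simp add: order_antisym)
qed

text \<open>Apply \<open>diff_le_iff\<close> to \<open>a + s\<close> and \<open>a\<close> for one
  inequality. For the other, let \<open>b\<close> be the preimage of \<open>\<phi> a + s\<close>;
  then \<open>b \<le> a + s\<close>, and \<phi> is monotone.\<close>

lemma shift:
  assumes a: "cpositive a" and s: "0 \<le> s"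
  shows "\<phi> (a + s *\<^sub>R e) = \<phi> a + s *\<^sub>R f"
proof (rule cpositive_antisym)
  have se: "cpositive (s *\<^sub>R e)" "cpositive (s *\<^sub>R f)"
    using e f s by (simp_all add: cpositive_scaleR cpositive_unity)
  have as: "cpositive (a + s *\<^sub>R e)" "cpositive (\<phi> a + s *\<^sub>R f)"
    using a se by (simp_all add: cpositive_add pos)
  show "cpositive (\<phi> a + s *\<^sub>R f - \<phi> (a + s *\<^sub>R e))"
    using diff_le_iff[OF as(1) a, of s] by (simp add: algebra_simps)
  define b where "b = \<psi> (\<phi> a + s *\<^sub>R f)"
  have b: "cpositive b" "\<phi> b = \<phi> a + s *\<^sub>R f"
    using as by (simp_all add: b_def pos' right)
  have "cpositive (s *\<^sub>R e - (b - a))"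
    using diff_le_iff[OF b(1) a, of s] by (simp add: b(2))
  then have "cpositive (\<phi> (a + s *\<^sub>R e) - \<phi> b)"
    using b as by (intro mono) (simp_all add: algebra_simps)
  then show "cpositive (\<phi> (a + s *\<^sub>R e) - (\<phi> a + s *\<^sub>R f))"
    by (simp add: b(2))
qed

section \<open>Extension to the self-adjoint elements\<close>

definition extension :: "'a \<Rightarrow> 'b"
  where "extension h = \<phi> (h + norm h *\<^sub>R e) - norm h *\<^sub>R f"

lemma cpositive_plus_unity:
  assumes "cstar h = h" "norm h \<le> t"
  shows "cpositive (h + t *\<^sub>R e)"
  using cpositive_unity_minus[OF e, of "- h" t] assms by (simp add: cstar_minus algebra_simps)

text \<open>By \<open>shift\<close> any sufficiently large translation into the cone gives the same
  value, so two elements can be translated by a common amount.\<close>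

lemma extension_eq:
  assumes h: "cstar h = h" and t: "norm h \<le> t"
  shows "extension h = \<phi> (h + t *\<^sub>R e) - t *\<^sub>R f"
proof -
  have "\<phi> ((h + norm h *\<^sub>R e) + (t - norm h) *\<^sub>R e) = \<phi> (h + norm h *\<^sub>R e) + (t - norm h) *\<^sub>R f"
    using h t by (intro shift cpositive_plus_unity) simp_all
  then show ?thesis by (simp add: extension_def algebra_simps)
qed

lemma extension_cpositive: "cpositive a \<Longrightarrow> extension a = \<phi> a"
  by (simp add: extension_def shift)

lemma cstar_extension: "cstar h = h \<Longrightarrow> cstar (extension h) = extension h"
  using cpositive_self_adjoint[OF pos[OF cpositive_plus_unity[of h "norm h"]]] f
  by (simp add: extension_def cstar_diff cstar_scaleR cstar_unity)

lemma norm_extension_diff: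
  assumes h: "cstar h = h" and k: "cstar k = k"
  shows "norm (extension h - extension k) = norm (h - k)"
proof -
  define t where "t = max (norm h) (norm k)"
  have t: "norm h \<le> t" "norm k \<le> t" by (simp_all add: t_def)
  show ?thesis
    using norm_diff[OF cpositive_plus_unity[OF h t(1)] cpositive_plus_unity[OF k t(2)]]
    by (simp add: extension_eq[OF h t(1)] extension_eq[OF k t(2)])
qed

lemma norm_extension: "cstar h = h \<Longrightarrow> norm (extension h) = norm h"
  using norm_extension_diff[of h 0] by (simp add: extension_cpositive scaleR_unity[of 0, simplified])

lemma inverse_extension:
  assumes h: "cstar h = h"
  shows "norm_additive_bijection.extension \<psi> f e (extension h) = h"
proof -
  interpret inv: norm_additive_bijection \<psi> \<phi> f e by (rule inverse)
  have "inv.extension (extension h) = \<psi> (extension h + norm h *\<^sub>R f) - norm h *\<^sub>R e"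
    using h by (intro inv.extension_eq) (simp_all add: cstar_extension norm_extension)
  also have "extension h + norm h *\<^sub>R f = \<phi> (h + norm h *\<^sub>R e)"
    by (simp add: extension_def)
  finally show ?thesis
    using cpositive_plus_unity[OF h order_refl] by (simp add: left)
qed

lemma bij_betw_extension: "bij_betw extension {h. cstar h = h} {h. cstar h = h}"
proof -
  interpret inv: norm_additive_bijection \<psi> \<phi> f e by (rule inverse)
  show ?thesis
    by (rule bij_betw_byWitness[where f' = inv.extension])
      (auto simp: cstar_extension inv.cstar_extension inverse_extension inv.inverse_extension)
qed

lemma extension_linear:
  shows "cstar h = h \<Longrightarrow> cstar k = k \<Longrightarrow> extension (h + k) = extension h + extension k"
    and "cstar h = h \<Longrightarrow> extension (r *\<^sub>R h) = r *\<^sub>R extension h"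
proof -
  \<comment> \<open>The type is kept generic because the fact serves both algebras.\<close>
  have subspace: "subspace {h. cstar h = (h::'c::cstar_algebra)}"
    by (simp add: subspace_def cstar_add cstar_scaleR)
  have 0: "extension 0 = 0" using norm_extension[of 0] by simp
  have iso: "norm (extension h - extension k) = norm (h - k)"
    if "h \<in> {h. cstar h = h}" "k \<in> {h. cstar h = h}" for h k
    using that by (simp add: norm_extension_diff)
  note MU = Mazur_Ulam[OF subspace subspace bij_betw_extension iso 0]
  show "extension (h + k) = extension h + extension k" if "cstar h = h" "cstar k = k"
    by (rule MU(1)) (simp_all add: that)
  show "extension (r *\<^sub>R h) = r *\<^sub>R extension h" if "cstar h = h"
    by (rule MU(2)) (simp_all add: that)
qed

section \<open>Complex-linear extension and preservation of squares\<close>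

definition complex_extension :: "'a \<Rightarrow> 'b"
  where "complex_extension x = extension (re_part x) + cscale \<i> (extension (im_part x))"

lemma complex_extension_self_adjoint: "cstar h = h \<Longrightarrow> complex_extension h = extension h"
  using norm_extension[of 0] by (simp add: complex_extension_def re_im_part_self_adjoint)

lemma complex_extension_cpositive: "cpositive a \<Longrightarrow> complex_extension a = \<phi> a"
  by (simp add: complex_extension_self_adjoint cpositive_self_adjoint extension_cpositive)

lemma complex_extension_add: "complex_extension (x + y) = complex_extension x + complex_extension y"
  by (simp add: complex_extension_def re_im_part_add extension_linear cscale_add_right)

lemma complex_extension_cscale: "complex_extension (cscale c x) = cscale c (complex_extension x)"
proof -
  have minus: "extension (h - k) = extension h - extension k" if "cstar h = h" "cstar k = k" for h k
    using extension_linear(1)[of h "- k"] extension_linear(2)[of k "- 1"] that by (simp add: cstar_minus)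
  have "cscale c (complex_extension x)
      = cscale (of_real (Re c) + \<i> * of_real (Im c)) (extension (re_part x) + cscale \<i> (extension (im_part x)))"
    by (simp add: complex_extension_def flip: complex_eq)
  also have "\<dots> = (Re c *\<^sub>R extension (re_part x) - Im c *\<^sub>R extension (im_part x))
      + cscale \<i> (Re c *\<^sub>R extension (im_part x) + Im c *\<^sub>R extension (re_part x))"
    by (simp add: cscale_add_left cscale_add_right cscale_of_real cscale_minus_left cscale_scaleR
        algebra_simps flip: cscale_cscale) (simp add: cscale_cscale cscale_minus_left cscale_one)
  also have "\<dots> = complex_extension (cscale c x)"
    by (simp add: complex_extension_def re_im_part_cscale extension_linear minus cstar_scaleR)
  finally show ?thesis ..
qed

lemma complex_extension_cstar: "complex_extension (cstar x) = cstar (complex_extension x)"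
  using extension_linear(2)[of "im_part x" "- 1"]
  by (simp add: complex_extension_def re_im_part_cstar cstar_add cstar_cscale cstar_extension
      cscale_minus_left cscale_minus_right)

lemma linear_complex_extension: "linear complex_extension"
  by (rule linearI) (simp_all add: complex_extension_add complex_extension_cscale flip: cscale_of_real)

lemma inverse_complex_extension:
  "norm_additive_bijection.complex_extension \<psi> f e (complex_extension x) = x"
proof -
  interpret inv: norm_additive_bijection \<psi> \<phi> f e by (rule inverse)
  show ?thesis
    by (simp add: inv.complex_extension_def complex_extension_def re_im_part_unique cstar_extension
        inverse_extension re_im_part_eq)
qed

lemma bij_complex_extension: "bij complex_extension"
proof -
  interpret inv: norm_additive_bijection \<psi> \<phi> f e by (rule inverse)
  show ?thesis
    by (rule bij_betw_byWitness[where f' = inv.complex_extension])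
      (simp_all add: inverse_complex_extension inv.inverse_complex_extension)
qed

lemma complex_extension_unity: "complex_extension e = f"
  using e scaleR_unity[of 1] by (simp add: complex_extension_cpositive cpositive_unity)

lemma complex_extension_square_ge:
  assumes "cpositive h" "cpositive (e - h)"
  shows "cpositive (complex_extension (h * h) - complex_extension h * complex_extension h)"
  using assms f e
  by (intro Kadison_inequality[OF linear_complex_extension])
    (simp_all add: complex_extension_cpositive complex_extension_unity pos)

text \<open>With \<open>k\<close> the image of \<open>h\<close>, Kadison's inequality for the
  inverse says that the preimage of \<open>k * k\<close> dominates \<open>h * h\<close>; applying
  the positive extension reverses the inequality already known.\<close>

lemma complex_extension_square_contraction:
  assumes h: "cpositive h" "cpositive (e - h)"
  shows "complex_extension (h * h) = complex_extension h * complex_extension h"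
proof (rule cpositive_antisym)
  interpret inv: norm_additive_bijection \<psi> \<phi> f e by (rule inverse)
  interpret lin: linear complex_extension by (rule linear_complex_extension)
  show "cpositive (complex_extension (h * h) - complex_extension h * complex_extension h)"
    using h by (rule complex_extension_square_ge)
  define k where "k = complex_extension h"
  have k: "cpositive k" "cpositive (f - k)"
    using pos[OF h(1)] pos[OF h(2)] complex_extension_cpositive[OF h(1)]
      complex_extension_cpositive[OF h(2)]
    by (simp_all add: k_def lin.diff complex_extension_unity)
  have "cpositive (inv.complex_extension (k * k) - h * h)"
    using inv.complex_extension_square_ge[OF k] by (simp add: k_def inverse_complex_extension)
  then have "cpositive (complex_extension (inv.complex_extension (k * k) - h * h))"
    by (simp add: complex_extension_cpositive pos)
  then show "cpositive (complex_extension h * complex_extension h - complex_extension (h * h))"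
    by (simp add: lin.diff inv.inverse_complex_extension k_def)
qed

lemma complex_extension_square_self_adjoint:
  assumes h: "cstar h = h"
  shows "complex_extension (h * h) = complex_extension h * complex_extension h"
proof -
  interpret lin: linear complex_extension by (rule linear_complex_extension)
  define t where "t = norm h + 1"
  have t: "0 < t" "norm h \<le> t" by (simp_all add: t_def add_nonneg_pos)
  \<comment> \<open>An affine change of variable moves \<open>h\<close> between 0 and
    \<open>e\<close>; the added 1 in \<open>t\<close> keeps the division legitimate for
    \<open>h = 0\<close>. Squares of \<open>h\<close> and \<open>g\<close> differ by affine terms in
    \<open>g\<close>.\<close>
  define g where "g = (1 / (2 * t)) *\<^sub>R (h + t *\<^sub>R e)"
  have hg: "h = (2 * t) *\<^sub>R g - t *\<^sub>R e" using t by (simp add: g_def)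
  have "cpositive g"
    using cpositive_plus_unity[OF h t(2)] t(1) by (simp add: g_def cpositive_scaleR)
  moreover have "e - g = (1 / (2 * t)) *\<^sub>R (t *\<^sub>R e - h)"
    using t by (simp add: g_def algebra_simps flip: scaleR_add_left)
  then have "cpositive (e - g)"
    using cpositive_unity_minus[OF e h t(2)] t(1) by (simp add: cpositive_scaleR)
  ultimately have gg: "complex_extension (g * g) = complex_extension g * complex_extension g"
    by (rule complex_extension_square_contraction)
  have "h * h = (4 * t * t) *\<^sub>R (g * g) - (4 * t * t) *\<^sub>R g + (t * t) *\<^sub>R e"
    using e by (simp add: hg algebra_simps is_unity_simps) (simp flip: scaleR_add_left)
  moreover have "complex_extension h * complex_extension h
      = (4 * t * t) *\<^sub>R complex_extension (g * g) - (4 * t * t) *\<^sub>R complex_extension g + (t * t) *\<^sub>R f"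
    using f by (simp add: hg gg lin.diff lin.scale complex_extension_unity algebra_simps is_unity_simps)
      (simp flip: scaleR_add_left)
  ultimately show ?thesis
    by (simp add: lin.diff lin.scale lin.add complex_extension_unity)
qed

lemma complex_extension_square: "complex_extension (x * x) = complex_extension x * complex_extension x"
proof -
  interpret lin: linear complex_extension by (rule linear_complex_extension)
  define J where "J = complex_extension"
  define h k where "h = re_part x" and "k = im_part x"
  have x: "x = h + cscale \<i> k" by (simp add: h_def k_def re_im_part_eq)
  have sa: "cstar h = h" "cstar k = k" "cstar (h + k) = h + k"
    by (simp_all add: h_def k_def cstar_add)
  have J: "J (y + z) = J y + J z" "J (y - z) = J y - J z" "J (cscale c y) = cscale c (J y)" for y z c
    by (simp_all add: J_def lin.add lin.diff complex_extension_cscale)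
  have sq: "J (h * h) = J h * J h" "J (k * k) = J k * J k" "J ((h + k) * (h + k)) = (J h + J k) * (J h + J k)"
    using sa by (simp_all add: complex_extension_square_self_adjoint lin.add J_def)
  \<comment> \<open>Polarization expresses the square of \<open>a + i b\<close> by the squares of
    \<open>a\<close>, \<open>b\<close> and \<open>a + b\<close>. It is used in both algebras, for
    \<open>h\<close>, \<open>k\<close> and for their images.\<close>
  have xx: "(a + cscale \<i> b) * (a + cscale \<i> b) = a * a - b * b + cscale \<i> ((a + b) * (a + b) - a * a - b * b)"
    for a b :: "'c::cstar_algebra"
    by (simp add: algebra_simps cscale_mult_left cscale_mult_right cscale_cscale cscale_minus_left
        cscale_one cscale_add_right cscale_diff_right)
  have "J (x * x) = J x * J x"
    unfolding x by (simp only: J xx sq)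
  then show ?thesis by (simp add: J_def)
qed

lemma jordan_star_iso_complex_extension: "jordan_star_iso complex_extension"
  by (simp add: jordan_star_iso_def bij_complex_extension complex_extension_add
      complex_extension_cscale complex_extension_cstar complex_extension_square)

end

section \<open>The two implications\<close>

lemma norm_add_surjection_imp_jordan_star_iso:
  fixes \<phi> :: "'a::cstar_algebra \<Rightarrow> 'b::cstar_algebra"
  assumes unital: "unital TYPE('a) \<or> unital TYPE('b)"
    and surj: "\<phi> ` positive_cone = positive_cone"
    and norm: "\<forall>A\<in>positive_cone. \<forall>B\<in>positive_cone. norm (\<phi> A + \<phi> B) = norm (A + B)"
  shows "\<exists>J. jordan_star_iso J \<and> (\<forall>A\<in>positive_cone. \<phi> A = J A)"
proof -
  have pos: "cpositive (\<phi> a)" if "cpositive a" for a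
    using surj that by (auto simp: positive_cone_def)
  have norm_add: "norm (\<phi> a + \<phi> b) = norm (a + b)" if "cpositive a" "cpositive b" for a b
    using norm that by (simp add: positive_cone_def)
  have ex: "\<exists>a. cpositive a \<and> \<phi> a = b" if "cpositive b" for b
    using surj that by (force simp: positive_cone_def)
  \<comment> \<open>A unit of the target has a positive preimage, which is a unit of the
    source.\<close>
  have "\<exists>e::'a. is_unity e"
    using unital
  proof
    assume "unital TYPE('b)"
    then obtain f :: 'b where f: "is_unity f" by (auto simp: unital_iff)
    obtain a where "cpositive a" "\<phi> a = 1 *\<^sub>R f"
      using ex[OF cpositive_unity[OF f]] by auto
    from is_unity_preimage[OF pos norm_add f this] show ?thesis by auto
  qed (simp add: unital_iff)
  then obtain e :: 'a where e: "is_unity e" ..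
  \<comment> \<open>Equal images give equal norms of sums with every positive \<open>c\<close>, and
    these norms determine the order, so \<open>a \<le> b\<close> and
    \<open>b \<le> a\<close>.\<close>
  have inj: "a = b" if "cpositive a" "cpositive b" "\<phi> a = \<phi> b" for a b
  proof (rule cpositive_antisym)
    have eq: "norm (a + c) = norm (b + c)" if "cpositive c" for c
      using norm_add \<open>cpositive a\<close> \<open>cpositive b\<close> that \<open>\<phi> a = \<phi> b\<close> by metis
    show "cpositive (b - a)" "cpositive (a - b)"
      using cpositive_diff_if_norm_add_le[OF e] that(1,2) eq by simp_all
  qed
  define \<psi> where "\<psi> b = (SOME a. cpositive a \<and> \<phi> a = b)" for b
  have \<psi>: "cpositive (\<psi> b)" "\<phi> (\<psi> b) = b" if "cpositive b" for b
    using someI_ex[OF ex[OF that]] by (simp_all add: \<psi>_def)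
  have left: "\<psi> (\<phi> a) = a" if "cpositive a" for a
    using that by (intro inj \<psi> pos)
  have \<psi>_norm: "norm (\<psi> b + \<psi> d) = norm (b + d)" if "cpositive b" "cpositive d" for b d
    using norm_add[OF \<psi>(1)[OF that(1)] \<psi>(1)[OF that(2)]] that by (simp add: \<psi>)
  have "\<psi> (\<phi> e) = 1 *\<^sub>R e" using e by (simp add: left cpositive_unity)
  from is_unity_preimage[OF \<psi>(1) \<psi>_norm e pos[OF cpositive_unity[OF e]] this]
  have "is_unity (\<phi> e)" by simp
  then interpret norm_additive_bijection \<phi> \<psi> e "\<phi> e"
    using e pos \<psi> left norm_add by unfold_locales
  show ?thesis
    using jordan_star_iso_complex_extension complex_extension_cpositive
    by (intro exI[of _ complex_extension]) (simp add: positive_cone_def)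
qed

text \<open>Expanding the square of \<open>e + x\<close> and using surjectivity gives
  \<open>E y + y E = 2 y\<close> for all \<open>y\<close>. As \<open>E\<close> is idempotent,
  multiplying by \<open>E\<close> on either side shows that \<open>E y\<close> and
  \<open>y E\<close> both equal \<open>E y E\<close>, hence \<open>y\<close>.\<close>

lemma jordan_star_iso_unity:
  assumes J: "jordan_star_iso J" and e: "is_unity e"
  shows "is_unity (J e)"
proof -
  have add: "J (x + y) = J x + J y" and sq: "J (x * x) = J x * J x" for x y
    using J by (simp_all add: jordan_star_iso_def)
  define E where "E = J e"
  have EE: "E * E = E" using sq[of e] e by (simp add: E_def is_unity_simps)
  have "E * J x + J x * E = J x + J x" for x
  proof -
    have "J ((e + x) * (e + x)) = (E + J x) * (E + J x)" by (simp add: sq add E_def)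
    moreover have "J ((e + x) * (e + x)) = E + (J x + J x) + J x * J x"
      using e by (simp add: algebra_simps is_unity_simps add sq E_def)
    ultimately show ?thesis by (simp add: algebra_simps EE)
  qed
  moreover have "surj J" using J by (simp add: jordan_star_iso_def bij_is_surj)
  ultimately have *: "E * y + y * E = y + y" for y by (metis surjD)
  have "E * y = y \<and> y * E = y" for y
  proof -
    have "E * (E * y + y * E) = E * (y + y)" "(E * y + y * E) * E = (y + y) * E"
      using *[of y] by simp_all
    moreover have "E * (E * y) = E * y" "y * E * E = y * E"
      using EE by (metis mult.assoc)+
    ultimately have "E * (y * E) = E * y" "E * (y * E) = y * E"
      by (simp_all add: distrib_left distrib_right mult.assoc)
    then have "E * y + E * y = y + y" "E * y = y * E" using *[of y] by simp_all
    then show ?thesis by (simp flip: scaleR_2)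
  qed
  then show ?thesis by (simp add: is_unity_def E_def)
qed

lemma jordan_star_iso_inv:
  assumes J: "jordan_star_iso J"
  shows "jordan_star_iso (inv J)"
proof -
  have "bij J" using J by (simp add: jordan_star_iso_def)
  then have "inj J" "surj J" by (simp_all add: bij_def)
  have J': "J (inv J y) = y" for y using \<open>surj J\<close> by (rule surj_f_inv_f)
  have eq: "inv J y = x \<longleftrightarrow> y = J x" for x y
    using \<open>inj J\<close> J' by (metis inv_f_f)
  show ?thesis
    using J \<open>bij J\<close> by (simp add: jordan_star_iso_def bij_imp_bij_inv eq J')
qed

lemma jordan_star_iso_imp_norm_add:
  fixes \<phi> :: "'a::cstar_algebra \<Rightarrow> 'b::cstar_algebra"
  assumes unital: "unital TYPE('a) \<or> unital TYPE('b)"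
    and surj: "\<phi> ` positive_cone = positive_cone"
    and J: "jordan_star_iso J" and eq: "\<forall>A\<in>positive_cone. \<phi> A = J A"
    and A: "A \<in> positive_cone" and B: "B \<in> positive_cone"
  shows "norm (\<phi> A + \<phi> B) = norm (A + B)"
proof -
  obtain e :: 'a where e: "is_unity e"
    using unital jordan_star_iso_unity[OF jordan_star_iso_inv[OF J]] by (auto simp: unital_iff)
  have f: "is_unity (J e)" using J e by (rule jordan_star_iso_unity)
  have add: "J (x + y) = J x + J y" for x y
    using J by (simp add: jordan_star_iso_def)
  have scale: "J (r *\<^sub>R x) = r *\<^sub>R J x" for r x
    using J by (simp add: jordan_star_iso_def flip: cscale_of_real)
  interpret J: linear J by (rule linearI) (simp_all add: add scale)
  have "inj J" using J by (simp add: jordan_star_iso_def bij_is_inj)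
  \<comment> \<open>Surjectivity of \<phi> carries over to \<open>J\<close> on the cones;
    injectivity of \<open>J\<close> then shows that \<open>J\<close> reflects positivity as
    well.\<close>
  have "J ` positive_cone = positive_cone" using surj eq by (metis image_cong)
  then have pos: "cpositive (J x) \<longleftrightarrow> cpositive x" for x
    using \<open>inj J\<close> inj_image_mem_iff[of J x positive_cone] by (simp add: positive_cone_def)
  have norm_iff: "norm (J p) \<le> t \<longleftrightarrow> norm p \<le> t" if p: "cpositive p" and t: "0 \<le> t" for p t
    using norm_le_iff_cpositive_unity_minus[OF e p t] norm_le_iff_cpositive_unity_minus[OF f _ t, of "J p"]
      pos[of p] pos[of "t *\<^sub>R e - p"] p by (simp add: J.diff J.scale)
  have "norm (J p) = norm p" if "cpositive p" for p
    using norm_iff[OF that, of "norm p"] norm_iff[OF that, of "norm (J p)"] by (simp add: order_antisym)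
  moreover have "cpositive (A + B)" using A B by (simp add: positive_cone_def cpositive_add)
  ultimately show ?thesis using eq A B by (simp add: flip: add)
qed

theorem theoremT:
  fixes \<phi> :: "'a::cstar_algebra \<Rightarrow> 'b::cstar_algebra"
  assumes "unital TYPE('a) \<or> unital TYPE('b)"
    and "\<phi> ` positive_cone = positive_cone"
  shows "(\<forall>A\<in>positive_cone. \<forall>B\<in>positive_cone. norm (\<phi> A + \<phi> B) = norm (A + B))
     \<longleftrightarrow> (\<exists>J::'a \<Rightarrow> 'b. jordan_star_iso J \<and> (\<forall>A\<in>positive_cone. \<phi> A = J A))"
  using norm_add_surjection_imp_jordan_star_iso[OF assms] jordan_star_iso_imp_norm_add[OF assms]
  by blast

end
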